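(* Let $D\subset\mathbb{R}^d$ be a bounded domain, let $0<\lambda<\Lambda$, let $\varphi\in H^1(D)$ and $f\in H^{-1}(D)$. Let $\{D_j : j=1,\ldots,n\}$ be a partition of $D$ into Lipschitz domains $D_1,\dots,D_n$, and let $a=\sum_{j=1}^n a_j\chi_{D_j}$ and $b=\sum_{j=1}^n b_j\chi_{D_j}$ with constants $a_j,b_j\in[\lambda,\Lambda]$ for $j=1,\dots,n$. Then for every $i\in\{1,\dots,n\}$, $$|a_i-b_i|\,\|f\|_{H^{-1}(D_i)}\le \Lambda^2\,\|\nabla(u_a-u_b)\|_{L^2(D_i)} .$$ In particular, if $\min\{\|f\|_{H^{-1}(D_i)} : i=1,\ldots,n\}>0$, then $u_a=u_b$ implies $a=b$.
   Context: For a measurable coefficient $a$ with $\lambda\le a\le\Lambda$ a.e. in $D$, $u_a\in H^1(D)$ denotes the unique weak solution of $-\operatorname{div}(a\nabla u)=f$ in $D$, $u|_{\partial D}=\varphi|_{\partial D}$, that is, $u_a-\varphi\in V:=H^1_0(D)$ and $\int_D a\nabla u_a\cdot\nabla v\,dx=f(v)$ for all $v\in V$. Here $H^{-1}(D)=V'$ is the dual of $H^1_0(D)$. A partition of $D$ means that the $D_j$ are pairwise disjoint open subsets of $D$ whose union is $D$ up to a set of Lebesgue measure zero. $\chi_{D_j}$ is the characteristic function of $D_j$. Functions in $H^1_0(D_i)$ are extended by zero to elements of $H^1_0(D)$, so $f$ restricts to an element of $H^{-1}(D_i)$, with dual norm $\|f\|_{H^{-1}(D_i)}=\sup\{f(v)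 : v\in H^1_0(D_i),\ \|\nabla v\|_{L^2(D_i)}\le 1\}$. *)

theory Defs
  imports "HOL-Analysis.Analysis"
begin

definition domain :: "'a::euclidean_space set \<Rightarrow> bool" where
  "domain U \<longleftrightarrow> open U \<and> connected U \<and> U \<noteq> {}"

(* Near each boundary point, U is the region strictly above the graph of a Lipschitz function
   of the coordinates orthogonal to a unit vector e; x - (x \<bullet> e) e is the projection of x
   onto the hyperplane orthogonal to e. *)
definition lipschitz_domain :: "'a::euclidean_space set \<Rightarrow> bool" where
  "lipschitz_domain U \<longleftrightarrow> domain U \<and>
     (\<forall>p \<in> frontier U. \<exists>N e L \<gamma>. open N \<and> p \<in> N \<and> norm e = 1 \<and>
        L-lipschitz_on {y. y \<bullet> e = 0} \<gamma> \<and>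
        U \<inter> N = {x \<in> N. x \<bullet> e > \<gamma> (x - (x \<bullet> e) *\<^sub>R e)})"

definition is_partition :: "nat \<Rightarrow> (nat \<Rightarrow> 'a::euclidean_space set) \<Rightarrow> 'a set \<Rightarrow> bool" where
  "is_partition n E D \<longleftrightarrow>
     (\<forall>j \<in> {1..n}. open (E j) \<and> E j \<subseteq> D) \<and>
     disjoint_family_on E {1..n} \<and>
     D - (\<Union>j \<in> {1..n}. E j) \<in> null_sets lebesgue"

definition piecewise_const :: "nat \<Rightarrow> (nat \<Rightarrow> 'a set) \<Rightarrow> (nat \<Rightarrow> real) \<Rightarrow> 'a \<Rightarrow> real" where
  "piecewise_const n E c = (\<lambda>x. \<Sum>j = 1..n. c j * indicator (E j) x)"

definition partial_deriv ::
    "'a \<Rightarrow> ('a::euclidean_space \<Rightarrow> real) \<Rightarrow> 'a \<Rightarrow> real" where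
  "partial_deriv e f = (\<lambda>x. frechet_derivative f (at x) e)"

primrec C_k :: "nat \<Rightarrow> ('a::euclidean_space \<Rightarrow> real) \<Rightarrow> bool" where
  "C_k 0 f \<longleftrightarrow> continuous_on UNIV f"
| "C_k (Suc k) f \<longleftrightarrow> f differentiable_on UNIV \<and> (\<forall>e \<in> Basis. C_k k (partial_deriv e f))"

definition test_functions :: "'a::euclidean_space set \<Rightarrow> ('a \<Rightarrow> real) set" where
  "test_functions U = {\<psi>. (\<forall>k. C_k k \<psi>) \<and> compact (closure {x. \<psi> x \<noteq> 0}) \<and>
     closure {x. \<psi> x \<noteq> 0} \<subseteq> U}"

(* Elements of Lebesgue and Sobolev spaces on U are represented by total functions whose
   values off U, or on null subsets of U, are irrelevant. Equality in these spaces is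
   equality almost everywhere on U. *)

definition L2 :: "'a::euclidean_space set \<Rightarrow> ('a \<Rightarrow> 'b::euclidean_space) set" where
  "L2 U = {f. f \<in> borel_measurable (lebesgue_on U) \<and>
     integrable (lebesgue_on U) (\<lambda>x. (norm (f x))\<^sup>2)}"

definition L2_norm :: "'a::euclidean_space set \<Rightarrow> ('a \<Rightarrow> 'b::euclidean_space) \<Rightarrow> real" where
  "L2_norm U f = sqrt (LINT x|lebesgue_on U. (norm (f x))\<^sup>2)"

definition has_weak_grad ::
    "'a::euclidean_space set \<Rightarrow> ('a \<Rightarrow> real) \<Rightarrow> ('a \<Rightarrow> 'a) \<Rightarrow> bool" where
  "has_weak_grad U u g \<longleftrightarrow> (\<forall>\<psi> \<in> test_functions U. \<forall>e \<in> Basis.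
     (LINT x|lebesgue_on U. u x * partial_deriv e \<psi> x) =
     - (LINT x|lebesgue_on U. (g x \<bullet> e) * \<psi> x))"

definition H1 :: "'a::euclidean_space set \<Rightarrow> ('a \<Rightarrow> real) set" where
  "H1 U = {u \<in> L2 U. \<exists>g \<in> L2 U. has_weak_grad U u g}"

(* For u in H1 U the weak gradient is unique up to null subsets of U;
   this picks a representative. *)
definition weak_grad :: "'a::euclidean_space set \<Rightarrow> ('a \<Rightarrow> real) \<Rightarrow> 'a \<Rightarrow> 'a" where
  "weak_grad U u = (SOME g. g \<in> L2 U \<and> has_weak_grad U u g)"

definition H1_norm :: "'a::euclidean_space set \<Rightarrow> ('a \<Rightarrow> real) \<Rightarrow> real" where
  "H1_norm U u = sqrt ((L2_norm U u)\<^sup>2 + (L2_norm U (weak_grad U u))\<^sup>2)"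

definition H10 :: "'a::euclidean_space set \<Rightarrow> ('a \<Rightarrow> real) set" where
  "H10 U = {v \<in> H1 U. \<exists>\<psi>. (\<forall>k::nat. \<psi> k \<in> test_functions U) \<and>
     (\<lambda>k. H1_norm U (\<lambda>x. \<psi> k x - v x)) \<longlonglongrightarrow> 0}"

(* The dual space of H10 U. Linearity and the norm bound force a functional to agree on
   functions that are equal almost everywhere on U. *)
definition Hm1 :: "'a::euclidean_space set \<Rightarrow> (('a \<Rightarrow> real) \<Rightarrow> real) set" where
  "Hm1 U = {f.
     (\<forall>v \<in> H10 U. \<forall>w \<in> H10 U. f (\<lambda>x. v x + w x) = f v + f w) \<and>
     (\<forall>c. \<forall>v \<in> H10 U. f (\<lambda>x. c * v x) = c * f v) \<and>
     (\<exists>C. \<forall>v \<in> H10 U. \<bar>f v\<bar> \<le> C * H1_norm U v)}"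

(* For bounded U and f in Hm1 U the supremum is over a bounded set, by the Poincare
   inequality, so the real-valued supremum is the actual one. *)
definition Hm1_norm :: "'a::euclidean_space set \<Rightarrow> (('a \<Rightarrow> real) \<Rightarrow> real) \<Rightarrow> real" where
  "Hm1_norm U f = (SUP v \<in> {v \<in> H10 U. L2_norm U (weak_grad U v) \<le> 1}. f v)"

definition zero_ext :: "'a set \<Rightarrow> ('a \<Rightarrow> real) \<Rightarrow> 'a \<Rightarrow> real" where
  "zero_ext U v = (\<lambda>x. if x \<in> U then v x else 0)"

definition restrict_dual ::
    "'a set \<Rightarrow> (('a \<Rightarrow> real) \<Rightarrow> real) \<Rightarrow> ('a \<Rightarrow> real) \<Rightarrow> real" where
  "restrict_dual U f = (\<lambda>v. f (zero_ext U v))"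

(* u is a weak solution of - div (a grad u) = f in D with u = \<phi> on the boundary *)
definition weak_solution ::
    "'a::euclidean_space set \<Rightarrow> ('a \<Rightarrow> real) \<Rightarrow> (('a \<Rightarrow> real) \<Rightarrow> real) \<Rightarrow> ('a \<Rightarrow> real) \<Rightarrow> ('a \<Rightarrow> real) \<Rightarrow> bool" where
  "weak_solution D a f \<phi> u \<longleftrightarrow> u \<in> H1 D \<and> (\<lambda>x. u x - \<phi> x) \<in> H10 D \<and>
     (\<forall>v \<in> H10 D. (LINT x|lebesgue_on D. a x * (weak_grad D u x \<bullet> weak_grad D v x)) = f v)"

end

theory Submission
  imports Defs
begin

text \<open>
Test functions that live in a single piece \<open>U = Dp i\<close> decide everything. Let \<open>v\<close> be an element of
\<open>H\<^sup>1\<^sub>0(U)\<close>, extended by zero to \<open>D\<close>. Both coefficients are constant on \<open>U\<close>, say \<open>\<alpha>\<close> and \<open>\<beta>\<close>, so the two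
weak formulations read \<open>f(v) = \<alpha> \<integral> \<nabla>ua \<bullet> \<nabla>v\<close> and \<open>f(v) = \<beta> \<integral> \<nabla>ub \<bullet> \<nabla>v\<close> with integrals over \<open>U\<close>. Eliminating
one integral gives \<open>(\<beta> - \<alpha>) f(v) = \<alpha> \<beta> \<integral> \<nabla>(ua - ub) \<bullet> \<nabla>v\<close>. Cauchy--Schwarz and the supremum over \<open>v\<close> give
the estimate (\<open>coefficient_stability_on_piece\<close>). If the two solutions agree almost everywhere, the
gradient of their difference is zero almost everywhere. The estimate then forces \<open>\<alpha> = \<beta>\<close> on each
piece where the dual norm of \<open>f\<close> is positive.

Two facts about weak gradients carry this argument. The first is that they are unique almost
everywhere (\<open>has_weak_grad_unique\<close>). Since \<^const>\<open>weak_grad\<close> selects an arbitrary representative, even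
the linearity of the gradient rests on it. It reduces to the fundamental lemma of the calculus of
variations, which needs a supply of test functions: products over the coordinates of shifted copies
of \<open>exp (- 1 / t)\<close>, which converge to indicators of boxes.

The second is that extension by zero maps \<open>H\<^sup>1\<^sub>0(U)\<close> into \<open>H\<^sup>1\<^sub>0(D)\<close> and extends the gradient by zero
(\<open>zero_ext_H10\<close>). It follows by approximation with test functions of \<open>U\<close>, for which integration by
parts holds because the integral of a partial derivative of a compactly supported \<open>C\<^sup>1\<close> function is zero.
\<close>

section \<open>Smooth bump functions on boxes\<close>

text \<open>The powers \<open>t ^ m\<close> in the denominator make the family closed under differentiation up to
linear combinations: no formula for the higher derivatives of \<open>exp (- 1 / t)\<close> is ever needed.\<close>
definition flat_exp :: "nat \<Rightarrow> real \<Rightarrow> real" where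
  "flat_exp m t = (if t > 0 then exp (- 1 / t) / t ^ m else 0)"

lemma flat_exp_tendsto_0: "(flat_exp m \<longlongrightarrow> 0) (at 0)"
proof (rule filterlim_split_at)
  show "(flat_exp m \<longlongrightarrow> 0) (at_left 0)"
    by (rule Lim_transform_eventually[OF tendsto_const])
       (auto simp: eventually_at_filter flat_exp_def)
  have "((\<lambda>t::real. inverse t ^ m / exp (inverse t)) \<longlongrightarrow> 0) (at_right 0)"
    by (rule filterlim_compose[OF tendsto_power_div_exp_0 filterlim_inverse_at_top_right])
  then show "(flat_exp m \<longlongrightarrow> 0) (at_right 0)"
    by (rule Lim_transform_eventually)
       (auto simp: eventually_at_filter flat_exp_def exp_minus field_simps)
qed

lemma flat_exp_has_derivative:
  "(flat_exp m has_real_derivative (flat_exp (m + 2) t - real m * flat_exp (m + 1) t)) (at t)"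
proof -
  consider "t > 0" | "t < 0" | "t = 0" by linarith
  then show ?thesis
  proof cases
    case 1
    have eq: "flat_exp (m + 2) t - real m * flat_exp (m + 1) t
        = (exp (- 1 / t) * (1 / t\<^sup>2) * t ^ m - exp (- 1 / t) * (real m * t ^ (m - 1))) / (t ^ m * t ^ m)"
      using 1 by (cases m) (auto simp: flat_exp_def field_simps power2_eq_square)
    have "((\<lambda>t. exp (- 1 / t) / t ^ m) has_real_derivative
        (exp (- 1 / t) * (1 / t\<^sup>2) * t ^ m - exp (- 1 / t) * (real m * t ^ (m - 1))) / (t ^ m * t ^ m)) (at t)"
      using 1 by (auto intro!: derivative_eq_intros simp: power2_eq_square)
    then have "((\<lambda>t. exp (- 1 / t) / t ^ m) has_real_derivative
        (flat_exp (m + 2) t - real m * flat_exp (m + 1) t)) (at t)" unfolding eq .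
    then show ?thesis
      by (rule DERIV_cong_ev[THEN iffD1, rotated -1])
         (use 1 in \<open>auto simp: flat_exp_def intro!: eventually_mono[OF eventually_nhds_in_open[of "{0<..}"]]\<close>)
  next
    case 2
    have "((\<lambda>_. 0) has_real_derivative (flat_exp (m + 2) t - real m * flat_exp (m + 1) t)) (at t)"
      using 2 by (simp add: flat_exp_def)
    then show ?thesis
      by (rule DERIV_cong_ev[THEN iffD1, rotated -1])
         (use 2 in \<open>auto simp: flat_exp_def intro!: eventually_mono[OF eventually_nhds_in_open[of "{..<0}"]]\<close>)
  next
    case 3
    \<comment> \<open>At the origin the difference quotient of one member of the family is the next member.\<close>
    have "((\<lambda>h. (flat_exp m (0 + h) - flat_exp m 0) / h) \<longlongrightarrow> 0) (at 0)"
      by (rule Lim_transform_eventually[OF flat_exp_tendsto_0[of "Suc m"]])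
         (auto simp: eventually_at_filter flat_exp_def field_simps)
    then show ?thesis using 3
      by (simp add: DERIV_def flat_exp_def)
  qed
qed

text \<open>Smoothness in the sense of \<^const>\<open>C_k\<close> is a statement about all iterated partial derivatives. It
follows by induction on \<open>k\<close> for any class of differentiable functions that is closed under partial
derivatives. This algebra is such a class, and it contains the bumps constructed below.\<close>
inductive flat_algebra :: "('a::euclidean_space \<Rightarrow> real) \<Rightarrow> bool" where
  const: "flat_algebra (\<lambda>x. c)"
| flat: "flat_algebra (\<lambda>x. flat_exp m (x \<bullet> p + c))"
| add: "flat_algebra f \<Longrightarrow> flat_algebra g \<Longrightarrow> flat_algebra (\<lambda>x. f x + g x)"
| mult: "flat_algebra f \<Longrightarrow> flat_algebra g \<Longrightarrow> flat_algebra (\<lambda>x. f x * g x)"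

lemma flat_algebra_prod:
  "finite I \<Longrightarrow> (\<And>i. i \<in> I \<Longrightarrow> flat_algebra (f i)) \<Longrightarrow> flat_algebra (\<lambda>x. \<Prod>i\<in>I. f i x)"
  by (induction I rule: finite_induct) (auto intro: flat_algebra.intros)

lemma flat_algebra_has_derivative:
  "flat_algebra f \<Longrightarrow> \<exists>f'. (\<forall>x. (f has_derivative f' x) (at x)) \<and> (\<forall>e. flat_algebra (\<lambda>x. f' x e))"
proof (induction rule: flat_algebra.induct)
  case (const c)
  show ?case by (rule exI[of _ "\<lambda>_ _. 0"]) (auto intro: flat_algebra.const)
next
  case (flat m p c)
  let ?d = "\<lambda>x::'a. flat_exp (m + 2) (x \<bullet> p + c) + (- real m) * flat_exp (m + 1) (x \<bullet> p + c)"
  have "((\<lambda>x. flat_exp m (x \<bullet> p + c)) has_derivative (\<lambda>e. ?d x * (e \<bullet> p))) (at x)" for x :: 'a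
  proof -
    have 1: "((\<lambda>x. x \<bullet> p + c) has_derivative (\<lambda>e. e \<bullet> p)) (at x)"
      by (auto intro!: derivative_eq_intros)
    have 2: "(flat_exp m has_derivative (*) (?d x)) (at (x \<bullet> p + c))"
      using flat_exp_has_derivative[of m "x \<bullet> p + c"]
      by (simp add: has_field_derivative_def)
    show ?thesis using has_derivative_compose[OF 1 2] by simp
  qed
  moreover have "flat_algebra (\<lambda>x. ?d x * (e \<bullet> p))" for e
    by (intro flat_algebra.intros)
  ultimately show ?case
    by (intro exI[of _ "\<lambda>x e. ?d x * (e \<bullet> p)"]) blast
next
  case (add f g)
  then obtain f' g' where "\<forall>x. (f has_derivative f' x) (at x)" "\<forall>e. flat_algebra (\<lambda>x. f' x e)"
      "\<forall>x. (g has_derivative g' x) (at x)" "\<forall>e. flat_algebra (\<lambda>x. g' x e)" by auto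
  then show ?case
    by (intro exI[of _ "\<lambda>x e. f' x e + g' x e"])
       (auto intro!: flat_algebra.add has_derivative_add)
next
  case (mult f g)
  then obtain f' g' where "\<forall>x. (f has_derivative f' x) (at x)" "\<forall>e. flat_algebra (\<lambda>x. f' x e)"
      "\<forall>x. (g has_derivative g' x) (at x)" "\<forall>e. flat_algebra (\<lambda>x. g' x e)" by auto
  then show ?case using mult.hyps
    by (intro exI[of _ "\<lambda>x e. f x * g' x e + f' x e * g x"])
       (auto intro!: flat_algebra.add flat_algebra.mult has_derivative_mult)
qed

lemma flat_algebra_differentiable:
  assumes "flat_algebra f" shows "f differentiable_on UNIV"
  using flat_algebra_has_derivative[OF assms]
  by (auto simp: differentiable_on_def differentiable_def)

lemma flat_algebra_partial_deriv:
  assumes "flat_algebra f" shows "flat_algebra (partial_deriv e f)"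
proof -
  obtain f' where "\<forall>x. (f has_derivative f' x) (at x)" "\<forall>e. flat_algebra (\<lambda>x. f' x e)"
    using flat_algebra_has_derivative[OF assms] by auto
  then have "partial_deriv e f = (\<lambda>x. f' x e)"
    unfolding partial_deriv_def by (metis frechet_derivative_at)
  with \<open>\<forall>e. flat_algebra (\<lambda>x. f' x e)\<close> show ?thesis by simp
qed

lemma flat_algebra_C_k: "flat_algebra f \<Longrightarrow> C_k k f"
  by (induction k arbitrary: f)
     (auto intro: flat_algebra_differentiable flat_algebra_partial_deriv
        differentiable_imp_continuous_on)

lemma zero_in_test_functions: "(\<lambda>x. 0) \<in> test_functions U"
  by (auto simp: test_functions_def intro: flat_algebra_C_k flat_algebra.const)

text \<open>The shift by \<open>1\<close> keeps the support away from the boundary of the box: it lies in the closed box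
shrunk by \<open>1 / k\<close> on each side. So the bump is a test function of the open box itself, and of
any open set that contains it, while the factors still tend to \<open>1\<close> inside as \<open>k\<close> grows.\<close>
definition box_bump :: "'a::euclidean_space \<Rightarrow> 'a \<Rightarrow> nat \<Rightarrow> 'a \<Rightarrow> real" where
  "box_bump a b k = (\<lambda>x. \<Prod>i\<in>Basis. flat_exp 0 (real k * (x \<bullet> i - a \<bullet> i) - 1)
                                    * flat_exp 0 (real k * (b \<bullet> i - x \<bullet> i) - 1))"

lemma flat_exp_0_bounds: "0 \<le> flat_exp 0 t" "flat_exp 0 t \<le> 1"
  by (auto simp: flat_exp_def)

lemma box_bump_bounds: "0 \<le> box_bump a b k x" "box_bump a b k x \<le> 1"
  unfolding box_bump_def
  by (auto intro!: prod_nonneg prod_le_1 mult_nonneg_nonneg mult_le_one flat_exp_0_bounds)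

lemma flat_exp_0_eq_0_iff: "flat_exp 0 t = 0 \<longleftrightarrow> t \<le> 0"
  by (auto simp: flat_exp_def)

lemma box_bump_nonzero_bounds:
  assumes "box_bump a b k x \<noteq> 0" "i \<in> Basis"
  shows "real k * (x \<bullet> i - a \<bullet> i) > 1" "real k * (b \<bullet> i - x \<bullet> i) > 1"
  using assms by (auto simp: box_bump_def flat_exp_0_eq_0_iff not_le)

lemma box_bump_in_test_functions:
  assumes "box a b \<subseteq> U" shows "box_bump a b k \<in> test_functions U"
proof -
  \<comment> \<open>For \<open>k = 0\<close> all factors vanish, so the empty set contains the support.\<close>
  let ?K = "if k = 0 then {} else cbox (a + (1 / real k) *\<^sub>R One) (b - (1 / real k) *\<^sub>R One)"
  have "{x. box_bump a b k x \<noteq> 0} \<subseteq> ?K"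
  proof
    fix x assume "x \<in> {x. box_bump a b k x \<noteq> 0}"
    then have *: "real k * (x \<bullet> i - a \<bullet> i) > 1" "real k * (b \<bullet> i - x \<bullet> i) > 1" if "i \<in> Basis" for i
      using box_bump_nonzero_bounds that by auto
    have "k \<noteq> 0" using *(1)[OF SOME_Basis] by (auto intro: ccontr)
    moreover have "1 / real k \<le> x \<bullet> i - a \<bullet> i" "1 / real k \<le> b \<bullet> i - x \<bullet> i" if "i \<in> Basis" for i
      using *[OF that] \<open>k \<noteq> 0\<close> by (auto simp: field_simps)
    ultimately show "x \<in> ?K"
      by (auto simp: mem_box inner_add_left inner_diff_left algebra_simps)
  qed
  then have cl: "closure {x. box_bump a b k x \<noteq> 0} \<subseteq> ?K"
    by (intro closure_minimal) (auto split: if_splits)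
  have "?K \<subseteq> box a b"
    by (auto simp: mem_box inner_add_left inner_diff_left)
       (smt (verit) divide_pos_pos of_nat_0_less_iff)+
  moreover have "compact (closure {x. box_bump a b k x \<noteq> 0})"
    by (rule compact_closure[THEN iffD2], rule bounded_subset[of ?K])
       (use \<open>{x. box_bump a b k x \<noteq> 0} \<subseteq> ?K\<close> in auto)
  moreover have "flat_algebra (box_bump a b k)"
  proof -
    have *: "flat_algebra (\<lambda>x::'a. flat_exp 0 (real k * (x \<bullet> i - a \<bullet> i) - 1))"
         "flat_algebra (\<lambda>x::'a. flat_exp 0 (real k * (b \<bullet> i - x \<bullet> i) - 1))" for i
      using flat_algebra.flat[of 0 "real k *\<^sub>R i" "- real k * (a \<bullet> i) - 1"]
        flat_algebra.flat[of 0 "- real k *\<^sub>R i" "real k * (b \<bullet> i) - 1"]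
      by (simp_all add: algebra_simps)
    show ?thesis unfolding box_bump_def
      by (intro flat_algebra_prod flat_algebra.mult * finite_Basis)
  qed
  ultimately show ?thesis
    using cl assms by (auto simp: test_functions_def intro: flat_algebra_C_k)
qed

lemma flat_exp_0_scaled_tendsto_1:
  assumes "t > 0" shows "(\<lambda>k. flat_exp 0 (real k * t - 1)) \<longlonglongrightarrow> 1"
proof -
  have lim: "filterlim (\<lambda>k. real k * t - 1) at_top sequentially"
    using filterlim_tendsto_add_at_top[OF tendsto_const[of "-1"]
        filterlim_at_top_mult_tendsto_pos[OF tendsto_const assms filterlim_real_sequentially]]
    by simp
  have "(\<lambda>k. exp (- 1 / (real k * t - 1))) \<longlonglongrightarrow> exp 0"
    by (intro tendsto_exp real_tendsto_divide_at_top[OF tendsto_const lim])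
  then have "(\<lambda>k. exp (- 1 / (real k * t - 1))) \<longlonglongrightarrow> 1" by simp
  then show ?thesis
    by (rule Lim_transform_eventually)
       (use lim[unfolded filterlim_at_top_dense, rule_format, of 0] in
         \<open>auto elim!: eventually_mono simp: flat_exp_def\<close>)
qed

lemma box_bump_tendsto:
  fixes x :: "'a::euclidean_space"
  shows "(\<lambda>k. box_bump a b k x) \<longlonglongrightarrow> indicator (box a b) x"
proof (cases "x \<in> box a b")
  case True
  have "(\<lambda>k. box_bump a b k x) \<longlonglongrightarrow> (\<Prod>i\<in>(Basis::'a set). 1 * 1)" unfolding box_bump_def
    by (intro tendsto_prod tendsto_mult flat_exp_0_scaled_tendsto_1) (use True in \<open>auto simp: mem_box\<close>)
  then show ?thesis using True by simp
next
  case False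
  then have "box_bump a b k x = 0" for k
  proof -
    obtain i where i: "i \<in> Basis" "x \<bullet> i - a \<bullet> i \<le> 0 \<or> b \<bullet> i - x \<bullet> i \<le> 0"
      using False by (auto simp: mem_box not_less)
    then have "real k * (x \<bullet> i - a \<bullet> i) \<le> 0 \<or> real k * (b \<bullet> i - x \<bullet> i) \<le> 0"
      by (meson mult_nonneg_nonpos of_nat_0_le_iff)
    then show ?thesis using box_bump_nonzero_bounds[of a b k x i] i by force
  qed
  then show ?thesis using False by simp
qed

lemma box_bump_zero_outside: "x \<notin> box a b \<Longrightarrow> box_bump a b k x = 0"
  using box_bump_in_test_functions[of a b "box a b" k] closure_subset[of "{x. box_bump a b k x \<noteq> 0}"]
  by (auto simp: test_functions_def)

section \<open>Square integrable functions\<close>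

lemma L2_measurable: "f \<in> L2 U \<Longrightarrow> f \<in> borel_measurable (lebesgue_on U)"
  by (simp add: L2_def)

lemma L2_integrable_norm_sq: "f \<in> L2 U \<Longrightarrow> integrable (lebesgue_on U) (\<lambda>x. (norm (f x))\<^sup>2)"
  by (simp add: L2_def)

lemma L2_norm_nonneg [simp]: "0 \<le> L2_norm U f"
  by (simp add: L2_norm_def)

lemma L2_norm_power2: "(L2_norm U f)\<^sup>2 = (LINT x|lebesgue_on U. (norm (f x))\<^sup>2)"
  by (simp add: L2_norm_def)

lemma L2_integrable_inner:
  assumes "f \<in> L2 U" "g \<in> L2 U"
  shows "integrable (lebesgue_on U) (\<lambda>x. f x \<bullet> g x)"
proof (rule Bochner_Integration.integrable_bound)
  show "integrable (lebesgue_on U) (\<lambda>x. (norm (f x))\<^sup>2 + (norm (g x))\<^sup>2)"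
    using assms by (intro Bochner_Integration.integrable_add L2_integrable_norm_sq)
  show "(\<lambda>x. f x \<bullet> g x) \<in> borel_measurable (lebesgue_on U)"
    using assms by (intro borel_measurable_inner L2_measurable)
  have "\<bar>f x \<bullet> g x\<bar> \<le> (norm (f x))\<^sup>2 + (norm (g x))\<^sup>2" for x
  proof -
    have "\<bar>f x \<bullet> g x\<bar> \<le> norm (f x) * norm (g x)" by (rule Cauchy_Schwarz_ineq2)
    also have "\<dots> \<le> (norm (f x))\<^sup>2 + (norm (g x))\<^sup>2"
      using sum_squares_bound[of "norm (f x)" "norm (g x)"]
        mult_nonneg_nonneg[OF norm_ge_zero norm_ge_zero, of "f x" "g x"] by linarith
    finally show ?thesis .
  qed
  then show "AE x in lebesgue_on U. norm (f x \<bullet> g x) \<le> norm ((norm (f x))\<^sup>2 + (norm (g x))\<^sup>2)"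
    by (auto intro!: AE_I2)
qed

lemma L2_diff:
  assumes "f \<in> L2 U" "g \<in> L2 U"
  shows "(\<lambda>x. f x - g x) \<in> L2 U"
proof -
  have "integrable (lebesgue_on U) (\<lambda>x. (norm (f x))\<^sup>2 + (norm (g x))\<^sup>2 - 2 * (f x \<bullet> g x))"
    using assms
    by (intro Bochner_Integration.integrable_add Bochner_Integration.integrable_diff
        integrable_mult_right L2_integrable_norm_sq L2_integrable_inner)
  also have "(\<lambda>x. (norm (f x))\<^sup>2 + (norm (g x))\<^sup>2 - 2 * (f x \<bullet> g x)) = (\<lambda>x. (norm (f x - g x))\<^sup>2)"
    by (simp add: power2_norm_eq_inner inner_diff inner_commute algebra_simps)
  finally show ?thesis
    using assms by (auto simp: L2_def)
qed

text \<open>The usual discriminant argument, applied to the nonnegative quadratic \<open>t \<mapsto> \<parallel>f - t g\<parallel>\<^sup>2\<close>.\<close>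
lemma L2_Cauchy_Schwarz:
  assumes "f \<in> L2 U" "g \<in> L2 U"
  shows "\<bar>LINT x|lebesgue_on U. f x \<bullet> g x\<bar> \<le> L2_norm U f * L2_norm U g"
proof -
  define A where "A = (L2_norm U f)\<^sup>2"
  define B where "B = (L2_norm U g)\<^sup>2"
  define I where "I = (LINT x|lebesgue_on U. f x \<bullet> g x)"
  have quad: "0 \<le> A - 2 * t * I + t\<^sup>2 * B" for t
  proof -
    have "0 \<le> (LINT x|lebesgue_on U. (norm (f x - t *\<^sub>R g x))\<^sup>2)" by simp
    also have "(\<lambda>x. (norm (f x - t *\<^sub>R g x))\<^sup>2)
        = (\<lambda>x. (norm (f x))\<^sup>2 - (2 * t) * (f x \<bullet> g x) + t\<^sup>2 * (norm (g x))\<^sup>2)"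
      by (simp only: power2_norm_eq_inner)
         (simp add: inner_diff inner_commute algebra_simps power2_eq_square)
    also have "(LINT x|lebesgue_on U. (norm (f x))\<^sup>2 - (2 * t) * (f x \<bullet> g x) + t\<^sup>2 * (norm (g x))\<^sup>2)
        = A - 2 * t * I + t\<^sup>2 * B"
      unfolding A_def B_def I_def L2_norm_power2 using assms
      by (simp add: L2_integrable_norm_sq L2_integrable_inner)
    finally show ?thesis .
  qed
  have "I\<^sup>2 \<le> A * B"
  proof (cases "B = 0")
    case True
    have "I = 0"
    proof (rule ccontr)
      assume "I \<noteq> 0"
      \<comment> \<open>For \<open>B = 0\<close> the quadratic is affine in \<open>t\<close>; here it would take the value \<open>-1\<close>.\<close>
      with quad[of "(A + 1) / (2 * I)"] True show False by simp
    qed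
    then show ?thesis using True by simp
  next
    case False
    then have "B > 0" by (simp add: B_def)
    with quad[of "I / B"] have "0 \<le> A - I\<^sup>2 / B"
      by (simp add: power2_eq_square field_simps)
    with \<open>B > 0\<close> show ?thesis by (simp add: field_simps)
  qed
  then have "\<bar>I\<bar> \<le> sqrt (A * B)" by (rule real_le_rsqrt[of "\<bar>I\<bar>", simplified])
  then show ?thesis by (simp add: A_def B_def I_def real_sqrt_mult)
qed

lemma L2_norm_cong_AE:
  assumes "f \<in> L2 U" "g \<in> L2 U" "AE x in lebesgue_on U. f x = g x"
  shows "L2_norm U f = L2_norm U g"
proof -
  have "(LINT x|lebesgue_on U. (norm (f x))\<^sup>2) = (LINT x|lebesgue_on U. (norm (g x))\<^sup>2)"
    using assms L2_integrable_norm_sq[OF assms(1)] L2_integrable_norm_sq[OF assms(2)]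
    by (intro integral_cong_AE) auto
  then show ?thesis by (simp add: L2_norm_def)
qed

lemma integral_lebesgue_on_vanishing_off:
  fixes f :: "'a::euclidean_space \<Rightarrow> 'b::{banach, second_countable_topology}"
  assumes "U \<in> sets lebesgue" "D \<in> sets lebesgue" "U \<subseteq> D" "\<And>x. x \<in> D - U \<Longrightarrow> f x = 0"
  shows "integral\<^sup>L (lebesgue_on D) f = integral\<^sup>L (lebesgue_on U) f"
proof -
  have "(\<lambda>x. indicator D x *\<^sub>R f x) = (\<lambda>x. indicator U x *\<^sub>R f x)"
    using assms(3,4) by (auto simp: indicator_def fun_eq_iff)
  then show ?thesis using assms by (simp add: integral_restrict_space)
qed

lemma integrable_lebesgue_on_vanishing_off:
  fixes f :: "'a::euclidean_space \<Rightarrow> 'b::{banach, second_countable_topology}"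
  assumes "U \<in> sets lebesgue" "D \<in> sets lebesgue" "U \<subseteq> D" "\<And>x. x \<in> D - U \<Longrightarrow> f x = 0"
  shows "integrable (lebesgue_on D) f \<longleftrightarrow> integrable (lebesgue_on U) f"
proof -
  have "(\<lambda>x. indicator D x *\<^sub>R f x) = (\<lambda>x. indicator U x *\<^sub>R f x)"
    using assms(3,4) by (auto simp: indicator_def fun_eq_iff)
  then show ?thesis using assms by (simp add: integrable_restrict_space)
qed

lemma L2_extend_by_0:
  fixes f :: "'a::euclidean_space \<Rightarrow> 'b::euclidean_space"
  assumes "U \<in> sets lebesgue" "D \<in> sets lebesgue" "U \<subseteq> D" "f \<in> L2 U"
  shows "(\<lambda>x. if x \<in> U then f x else 0) \<in> L2 D"
    and "L2_norm D (\<lambda>x. if x \<in> U then f x else 0) = L2_norm U f"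
proof -
  let ?F = "\<lambda>x. (norm (if x \<in> U then f x else 0))\<^sup>2"
  have "integrable (lebesgue_on D) ?F \<longleftrightarrow> integrable (lebesgue_on U) ?F"
    using assms by (intro integrable_lebesgue_on_vanishing_off) auto
  also have "\<dots> \<longleftrightarrow> integrable (lebesgue_on U) (\<lambda>x. (norm (f x))\<^sup>2)"
    by (intro Bochner_Integration.integrable_cong) auto
  finally show "(\<lambda>x. if x \<in> U then f x else 0) \<in> L2 D"
    using assms by (auto simp: L2_def borel_measurable_if_lebesgue_on)
  have "integral\<^sup>L (lebesgue_on D) ?F = integral\<^sup>L (lebesgue_on U) ?F"
    using assms by (intro integral_lebesgue_on_vanishing_off) auto
  also have "\<dots> = (LINT x|lebesgue_on U. (norm (f x))\<^sup>2)"
    by (intro Bochner_Integration.integral_cong) auto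
  finally show "L2_norm D (\<lambda>x. if x \<in> U then f x else 0) = L2_norm U f"
    by (simp add: L2_norm_def)
qed

lemma L2_subset:
  fixes f :: "'a::euclidean_space \<Rightarrow> 'b::euclidean_space"
  assumes "U \<in> sets lebesgue" "D \<in> sets lebesgue" "U \<subseteq> D" "f \<in> L2 D"
  shows "f \<in> L2 U"
proof -
  have "integrable (lebesgue_on U) (\<lambda>x. (norm (f x))\<^sup>2)"
  proof -
    have "integrable lebesgue (\<lambda>x. indicator D x *\<^sub>R (norm (f x))\<^sup>2)"
      using L2_integrable_norm_sq[OF assms(4)] assms(2) by (simp add: integrable_restrict_space)
    then have "integrable lebesgue (\<lambda>x. indicator U x *\<^sub>R (indicator D x *\<^sub>R (norm (f x))\<^sup>2))"
      using assms(1) by (rule integrable_mult_indicator[rotated])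
    also have "(\<lambda>x. indicator U x *\<^sub>R (indicator D x *\<^sub>R (norm (f x))\<^sup>2))
        = (\<lambda>x. indicator U x *\<^sub>R (norm (f x))\<^sup>2)"
      using assms(3) by (auto simp: indicator_def fun_eq_iff)
    finally show ?thesis using assms(1) by (simp add: integrable_restrict_space)
  qed
  then show ?thesis
    using assms measurable_restrict_mono[OF L2_measurable[OF assms(4)] assms(3)]
    by (simp add: L2_def)
qed

lemma L2_continuous_compact_support:
  fixes f :: "'a::euclidean_space \<Rightarrow> 'b::euclidean_space"
  assumes U: "U \<in> sets lebesgue" and "compact K" and cont: "continuous_on UNIV f"
    and zero: "\<And>x. x \<notin> K \<Longrightarrow> f x = 0"
  shows "f \<in> L2 U"
proof -
  have "integrable lborel (\<lambda>x. indicator K x *\<^sub>R (norm (f x))\<^sup>2)"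
    using assms(2) cont by (intro borel_integrable_compact) (auto intro!: continuous_intros intro: continuous_on_subset)
  also have "(\<lambda>x. indicator K x *\<^sub>R (norm (f x))\<^sup>2) = (\<lambda>x. (norm (f x))\<^sup>2)"
    using zero by (auto simp: indicator_def fun_eq_iff)
  finally have "integrable lborel (\<lambda>x. (norm (f x))\<^sup>2)" .
  then have int: "integrable lebesgue (\<lambda>x. (norm (f x))\<^sup>2)"
    by (simp add: integrable_completion borel_measurable_integrable)
  have "f \<in> borel_measurable (lebesgue_on UNIV)"
    using cont by (intro continuous_imp_measurable_on_sets_lebesgue) auto
  then have "f \<in> L2 UNIV"
    using int by (simp add: L2_def lebesgue_on_UNIV_eq)
  then show ?thesis by (rule L2_subset[OF U, rotated -1]) auto
qed

section \<open>Integrals of partial derivatives\<close>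

lemma integral_translate:
  fixes h :: "'a::euclidean_space \<Rightarrow> real"
  assumes "h \<in> borel_measurable borel"
  shows "(LINT x|lborel. h (c + x)) = (LINT x|lborel. h x)"
proof -
  have "(LINT x|lborel. h x) = (LINT x|distr lborel borel ((+) c). h x)"
    by (simp add: lborel_distr_plus)
  also have "\<dots> = (LINT x|lborel. h (c + x))"
    using assms by (intro integral_distr) auto
  finally show ?thesis by simp
qed

text \<open>Translation invariance replaces Fubini here. The difference quotients of \<open>h\<close> in direction \<open>e\<close> all
have integral zero, are supported in one ball and are bounded by the maximum of the partial
derivative (mean value theorem). Dominated convergence passes this on to the derivative.\<close>
lemma integral_partial_deriv_eq_0:
  fixes h :: "'a::euclidean_space \<Rightarrow> real"
  assumes diff: "h differentiable_on UNIV" and cont: "continuous_on UNIV (partial_deriv e h)"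
    and "compact K" and zero: "\<And>x. x \<notin> K \<Longrightarrow> h x = 0" "\<And>x. x \<notin> K \<Longrightarrow> partial_deriv e h x = 0"
  shows "(LINT x|lborel. partial_deriv e h x) = 0"
proof -
  have cont_h: "continuous_on UNIV h" using diff by (rule differentiable_imp_continuous_on)
  then have meas: "h \<in> borel_measurable borel" by (rule borel_measurable_continuous_onI)
  have deriv: "((\<lambda>t. h (x + t *\<^sub>R e)) has_real_derivative partial_deriv e h (x + t *\<^sub>R e)) (at t)" for x t
  proof -
    have 1: "((\<lambda>t. x + t *\<^sub>R e) has_derivative (\<lambda>s. s *\<^sub>R e)) (at t)"
      by (auto intro!: derivative_eq_intros)
    have 2: "(h has_derivative frechet_derivative h (at (x + t *\<^sub>R e))) (at (x + t *\<^sub>R e))"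
      using diff by (simp add: differentiable_on_def flip: frechet_derivative_works)
    have lin: "linear (frechet_derivative h (at (x + t *\<^sub>R e)))"
      using 2 by (rule has_derivative_linear)
    show ?thesis
      using has_derivative_compose[OF 1 2]
      unfolding has_field_derivative_def partial_deriv_def linear_scale[OF lin]
      by (rule has_derivative_eq_rhs) (simp add: fun_eq_iff)
  qed
  have "bounded (partial_deriv e h ` K)"
    using compact_continuous_image[OF continuous_on_subset[OF cont]] \<open>compact K\<close> compact_imp_bounded by blast
  then obtain M0 where M0: "\<And>x. x \<in> K \<Longrightarrow> \<bar>partial_deriv e h x\<bar> \<le> M0"
    by (auto simp: bounded_iff)
  define M where "M = \<bar>M0\<bar>"
  have M: "\<bar>partial_deriv e h x\<bar> \<le> M" for x
    using M0[of x] zero(2)[of x] by (cases "x \<in> K") (auto simp: M_def)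
  define q where "q k x = (h (x + (1 / real (Suc k)) *\<^sub>R e) - h x) / (1 / real (Suc k))" for k x
  have bound: "\<bar>q k x\<bar> \<le> M" for k x
  proof -
    have "\<exists>z. 0 < z \<and> z < 1 / real (Suc k) \<and>
        h (x + (1 / real (Suc k)) *\<^sub>R e) - h (x + 0 *\<^sub>R e)
          = (1 / real (Suc k) - 0) * partial_deriv e h (x + z *\<^sub>R e)"
      by (rule MVT2) (use deriv in auto)
    then obtain z where "h (x + (1 / real (Suc k)) *\<^sub>R e) - h x
        = 1 / real (Suc k) * partial_deriv e h (x + z *\<^sub>R e)" by auto
    then have "q k x = partial_deriv e h (x + z *\<^sub>R e)"
      unfolding q_def by simp
    then show ?thesis using M by simp
  qed
  have lim: "(\<lambda>k. q k x) \<longlonglongrightarrow> partial_deriv e h x" for x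
  proof -
    have "((\<lambda>t. (h (x + t *\<^sub>R e) - h x) / t) \<longlongrightarrow> partial_deriv e h x) (at 0)"
      using deriv[of x 0] by (simp add: DERIV_def)
    moreover have "filterlim (\<lambda>k. 1 / real (Suc k)) (at 0) sequentially"
      using LIMSEQ_inverse_real_of_nat by (intro filterlim_atI) (auto simp: inverse_eq_divide)
    ultimately show ?thesis unfolding q_def by (rule filterlim_compose)
  qed
  obtain R where R: "\<And>x. x \<in> K \<Longrightarrow> norm x \<le> R"
    using compact_imp_bounded[OF \<open>compact K\<close>] by (auto simp: bounded_iff)
  let ?S = "cball 0 (R + norm e) :: 'a set"
  have q0: "q k x = 0" if "x \<notin> ?S" for k x
  proof -
    have *: "norm x > R + norm e" using that by (simp add: not_le)
    have "norm ((1 / real (Suc k)) *\<^sub>R e) \<le> norm e"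
      by (simp add: divide_le_eq distrib_left)
    then have "norm (x + (1 / real (Suc k)) *\<^sub>R e) > R"
      using * norm_triangle_ineq2[of x "- (1 / real (Suc k)) *\<^sub>R e"] by simp
    moreover have "norm x > R" using * norm_ge_zero[of e] by linarith
    ultimately have "x \<notin> K" "x + (1 / real (Suc k)) *\<^sub>R e \<notin> K"
      using R[of x] R[of "x + (1 / real (Suc k)) *\<^sub>R e"] by linarith+
    then show ?thesis by (simp add: q_def zero(1))
  qed
  have int_h: "integrable lborel h"
  proof -
    have "integrable lborel (\<lambda>x. indicator K x *\<^sub>R h x)"
      using \<open>compact K\<close> continuous_on_subset[OF cont_h] by (intro borel_integrable_compact) auto
    also have "(\<lambda>x. indicator K x *\<^sub>R h x) = h"
      using zero(1) by (auto simp: indicator_def fun_eq_iff)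
    finally show ?thesis .
  qed
  have int_ht: "integrable lborel (\<lambda>x. h (x + c))" for c
  proof -
    have "integrable (distr lborel borel ((+) c)) h"
      using int_h by (simp add: lborel_distr_plus)
    then have "integrable lborel (\<lambda>x. h (c + x))"
      by (rule integrable_distr[rotated]) simp
    then show ?thesis by (simp add: add.commute)
  qed
  have int_shift: "(LINT x|lborel. h (x + c)) = (LINT x|lborel. h x)" for c
    using integral_translate[OF meas, of c] by (simp add: add.commute)
  have q_int: "(LINT x|lborel. q k x) = 0" for k
    unfolding q_def using int_h int_ht
    by (simp add: int_shift del: of_nat_Suc)
  have "(\<lambda>k. LINT x|lborel. q k x) \<longlonglongrightarrow> (LINT x|lborel. partial_deriv e h x)"
  proof (rule integral_dominated_convergence)
    show "partial_deriv e h \<in> borel_measurable lborel"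
      using borel_measurable_continuous_onI[OF cont] by simp
    show "q k \<in> borel_measurable lborel" for k
      unfolding q_def using meas by measurable
    show "integrable lborel (\<lambda>x. M * indicator ?S x)"
      using emeasure_bounded_finite[OF bounded_cball, of 0 "R + norm e"]
      by (intro integrable_mult_right integrable_real_indicator) auto
    show "AE x in lborel. (\<lambda>k. q k x) \<longlonglongrightarrow> partial_deriv e h x"
      by (rule AE_I2) (rule lim)
    show "AE x in lborel. norm (q k x) \<le> M * indicator ?S x" for k
    proof (rule AE_I2)
      fix x show "norm (q k x) \<le> M * indicator ?S x"
        using bound[of k x] q0[of x k] by (cases "x \<in> ?S") simp_all
    qed
  qed
  then have "(\<lambda>k. 0) \<longlonglongrightarrow> (LINT x|lborel. partial_deriv e h x)"
    by (simp only: q_int)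
  then show ?thesis by (simp add: LIMSEQ_const_iff)
qed

section \<open>The fundamental lemma of the calculus of variations\<close>

lemma sigma_finite_lebesgue: "sigma_finite_measure (lebesgue :: 'a::euclidean_space measure)"
proof
  obtain A :: "'a set set" where A: "countable A \<and> A \<subseteq> sets lborel \<and> \<Union>A = space lborel \<and>
      (\<forall>a\<in>A. emeasure lborel a \<noteq> \<infinity>)"
    using lborel.sigma_finite_countable ..
  moreover have "emeasure lebesgue a = emeasure lborel a" if "a \<in> A" for a
  proof -
    have "a \<in> sets lborel" using that A by blast
    then show ?thesis by simp
  qed
  ultimately show "\<exists>A. countable A \<and> A \<subseteq> sets lebesgue \<and> \<Union>A = space (lebesgue :: 'a measure) \<and>
      (\<forall>a\<in>A. emeasure lebesgue a \<noteq> \<infinity>)"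
    by (intro exI[of _ A]) (simp add: subset_iff)
qed

text \<open>The sets over which \<open>h\<close> integrates to zero form a Dynkin system; the whole space belongs to it
as the limit of growing boxes. Open boxes generate the Borel sets and are closed under intersection, and Lebesgue sets differ from Borel sets by null sets.\<close>
lemma integral_eq_0_boxes_imp_AE_eq_0:
  fixes h :: "'a::euclidean_space \<Rightarrow> real"
  assumes int: "integrable lebesgue h"
    and box: "\<And>a b. (LINT x:box a b|lebesgue. h x) = 0"
  shows "AE x in lebesgue. h x = 0"
proof (rule sigma_finite_measure.density_zero[OF sigma_finite_lebesgue int])
  have set_int: "set_integrable lebesgue A h" if "A \<in> sets lebesgue" for A
    using integrable_mult_indicator[OF that int] by (simp add: set_integrable_def)
  have total: "(LINT x|lebesgue. h x) = 0"
  proof -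
    let ?B = "\<lambda>n::nat. box (- (real n *\<^sub>R One)) (real n *\<^sub>R One) :: 'a set"
    have "incseq ?B"
      by (auto simp: incseq_def mem_box) (smt (verit) of_nat_mono)+
    then have "(\<lambda>n. LINT x:?B n|lebesgue. h x) \<longlonglongrightarrow> (LINT x:(\<Union>n. ?B n)|lebesgue. h x)"
      by (intro set_integral_cont_up set_int) (auto simp: UN_box_eq_UNIV)
    then have "(LINT x:(UNIV::'a set)|lebesgue. h x) = 0"
      by (simp add: box UN_box_eq_UNIV LIMSEQ_const_iff)
    then show ?thesis by (simp add: set_lebesgue_integral_def)
  qed
  let ?E = "range (\<lambda>(a, b). box a b :: 'a set)"
  have borel: "(LINT x:A|lebesgue. h x) = 0" if "A \<in> sets borel" for A
  proof -
    have "Int_stable ?E" by (auto simp: Int_stable_def box_Int_box)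
    moreover have "?E \<subseteq> Pow UNIV" by simp
    moreover have "A \<in> sigma_sets UNIV ?E" using that by (simp add: borel_eq_box)
    ultimately show ?thesis
    proof (induction rule: sigma_sets_induct_disjoint)
      case (basic A)
      then show ?case using box by auto
    next
      case empty
      show ?case by (simp add: set_lebesgue_integral_def)
    next
      case (compl A)
      have A: "A \<in> sets borel" using compl(1) by (simp add: borel_eq_box)
      then have "(LINT x:A \<union> (UNIV - A)|lebesgue. h x)
          = (LINT x:A|lebesgue. h x) + (LINT x:UNIV - A|lebesgue. h x)"
        by (intro set_integral_Un set_int) auto
      then show ?case using compl(2) total by (simp add: set_lebesgue_integral_def)
    next
      case (union A)
      have A: "A i \<in> sets borel" for i using union(2) by (auto simp: borel_eq_box)
      have "(LINT x:(\<Union>i. A i)|lebesgue. h x) = (\<Sum>i. (LINT x:(A i)|lebesgue. h x))"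
        using union(1) A by (intro lebesgue_integral_countable_add set_int)
          (auto simp: disjoint_family_on_def)
      then show ?case using union(3) by simp
    qed
  qed
  fix A :: "'a set" assume "A \<in> sets lebesgue"
  then obtain S N N' where A: "A = S \<union> N" "N \<subseteq> N'" "N' \<in> null_sets lborel" "S \<in> sets lborel"
    by (rule sets_completionE)
  have "AE x in lebesgue. x \<notin> N'"
    using A(3) by (intro AE_not_in null_sets_completionI)
  then have "AE x in lebesgue. indicator A x *\<^sub>R h x = indicator S x *\<^sub>R h x"
    by eventually_elim (use A in \<open>auto simp: indicator_def\<close>)
  moreover have "S \<in> sets lebesgue" using A(4) by simp
  ultimately have "(LINT x:A|lebesgue. h x) = (LINT x:S|lebesgue. h x)"
    unfolding set_lebesgue_integral_def
    using set_int[of A] set_int[of S] \<open>A \<in> sets lebesgue\<close>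
    by (intro integral_cong_AE) (auto simp: set_integrable_def)
  then show "(LINT x:A|lebesgue. h x) = 0" using borel A(4) by simp
qed

text \<open>The fundamental lemma of the calculus of variations. Dominated convergence along the bumps shows that
\<open>h\<close> integrates to zero over every open box contained in \<open>U\<close>. Hence \<open>h\<close> vanishes almost everywhere in
each such box, and countably many of them cover \<open>U\<close>.\<close>
lemma AE_eq_0_if_orthogonal_test_functions:
  fixes h :: "'a::euclidean_space \<Rightarrow> real"
  assumes U: "open U" and h: "h \<in> L2 U"
    and orth: "\<And>\<psi>. \<psi> \<in> test_functions U \<Longrightarrow> (LINT x|lebesgue_on U. h x * \<psi> x) = 0"
  shows "AE x in lebesgue_on U. h x = 0"
proof -
  have U_sets: "U \<in> sets lebesgue" using U by auto
  define H where "H x = (if x \<in> U then h x else 0)" for x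
  have H_L2: "H \<in> L2 UNIV"
    unfolding H_def using U_sets h by (intro L2_extend_by_0) auto
  have H_int: "integrable lebesgue (\<lambda>x. indicator (box a b) x * H x)" for a b
  proof -
    have "(indicator (box a b) :: _ \<Rightarrow> real) \<in> L2 (UNIV :: 'a set)"
    proof -
      have "integrable lebesgue (indicator (box a b) :: 'a \<Rightarrow> real)"
        using emeasure_bounded_finite[OF bounded_box, of a b]
        by (intro integrable_real_indicator) auto
      moreover have "(norm (indicator (box a b) x :: real))\<^sup>2 = indicator (box a b) x" for x
        by (simp add: indicator_def)
      ultimately show ?thesis
        by (simp only: L2_def lebesgue_on_UNIV_eq mem_Collect_eq) (blast intro: borel_measurable_integrable)
    qed
    from L2_integrable_inner[OF this H_L2] show ?thesis
      by (simp only: lebesgue_on_UNIV_eq inner_real_def)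
  qed
  have H_box: "(LINT x|lebesgue. indicator (box a b) x * H x) = 0" if "box a b \<subseteq> U" for a b
  proof -
    have 0: "(LINT x|lebesgue. box_bump a b k x * H x) = 0" for k
    proof -
      have "(LINT x|lebesgue. box_bump a b k x * H x) = (LINT x|lebesgue_on U. box_bump a b k x * H x)"
        using integral_lebesgue_on_vanishing_off[OF U_sets, of UNIV "\<lambda>x. box_bump a b k x * H x"]
        by (simp add: lebesgue_on_UNIV_eq H_def)
      also have "\<dots> = (LINT x|lebesgue_on U. h x * box_bump a b k x)"
        by (rule Bochner_Integration.integral_cong) (simp_all add: H_def)
      also have "\<dots> = 0" using that by (intro orth box_bump_in_test_functions)
      finally show ?thesis .
    qed
    have "(\<lambda>k. LINT x|lebesgue. box_bump a b k x * H x)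
        \<longlonglongrightarrow> (LINT x|lebesgue. indicator (box a b) x * H x)"
    proof (rule integral_dominated_convergence)
      have H_meas: "H \<in> borel_measurable lebesgue"
        using L2_measurable[OF H_L2] by (simp add: lebesgue_on_UNIV_eq)
      show "(\<lambda>x. indicator (box a b) x * H x) \<in> borel_measurable lebesgue"
        using H_int[of a b] by auto
      have "box_bump a b k \<in> borel_measurable lborel" for k
      proof -
        have "C_k 0 (box_bump a b k)"
          using box_bump_in_test_functions[of a b UNIV k] unfolding test_functions_def by blast
        then have "box_bump a b k \<in> borel_measurable borel"
          by (intro borel_measurable_continuous_onI) simp
        then show ?thesis by simp
      qed
      then have "box_bump a b k \<in> borel_measurable lebesgue" for k
        by (rule measurable_completion)
      then show "(\<lambda>x. box_bump a b k x * H x) \<in> borel_measurable lebesgue" for k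
        by (intro borel_measurable_times H_meas)
      show "integrable lebesgue (\<lambda>x. norm (indicator (box a b) x * H x))"
        using H_int by (rule integrable_norm)
      show "AE x in lebesgue. (\<lambda>k. box_bump a b k x * H x) \<longlonglongrightarrow> indicator (box a b) x * H x"
        by (intro AE_I2 tendsto_mult box_bump_tendsto tendsto_const)
      show "AE x in lebesgue. norm (box_bump a b k x * H x) \<le> norm (indicator (box a b) x * H x)" for k
      proof (rule AE_I2)
        fix x
        have "\<bar>box_bump a b k x\<bar> \<le> indicator (box a b) x"
          using box_bump_bounds[of a b k x] box_bump_zero_outside[of x a b k]
          by (cases "x \<in> box a b") simp_all
        then show "norm (box_bump a b k x * H x) \<le> norm (indicator (box a b) x * H x)"
          by (simp add: abs_mult mult_right_mono)
      qed
    qed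
    then show ?thesis by (simp add: 0 LIMSEQ_const_iff)
  qed
  have AE_box: "AE x in lebesgue. x \<in> box c d \<longrightarrow> h x = 0" if "box c d \<subseteq> U" for c d
  proof -
    have "AE x in lebesgue. indicator (box c d) x * H x = 0"
    proof (rule integral_eq_0_boxes_imp_AE_eq_0[OF H_int])
      fix a b :: 'a
      obtain a' b' where ab: "box a b \<inter> box c d = box a' b'"
        using box_Int_box[of a b c d] by blast
      have "(LINT x:box a b|lebesgue. indicator (box c d) x * H x)
          = (LINT x|lebesgue. indicator (box a' b') x * H x)"
        unfolding set_lebesgue_integral_def ab[symmetric]
        by (intro Bochner_Integration.integral_cong) (auto simp: indicator_def)
      also have "\<dots> = 0" using ab that by (intro H_box) blast
      finally show "(LINT x:box a b|lebesgue. indicator (box c d) x * H x) = 0" .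
    qed
    then show ?thesis
      by eventually_elim (use that in \<open>auto simp: H_def\<close>)
  qed
  obtain \<D> where \<D>: "countable \<D>" "\<D> \<subseteq> Pow U" "\<And>X. X \<in> \<D> \<Longrightarrow> \<exists>a b. X = box a b" "\<Union>\<D> = U"
    using open_countable_Union_open_box[OF U] by blast
  have "AE x in lebesgue. \<forall>X\<in>\<D>. x \<in> X \<longrightarrow> h x = 0"
    unfolding AE_ball_countable[OF \<D>(1)]
  proof
    fix X assume X: "X \<in> \<D>"
    then obtain a b where "X = box a b" using \<D>(3) by blast
    with X \<D>(2) AE_box[of a b] show "AE x in lebesgue. x \<in> X \<longrightarrow> h x = 0" by auto
  qed
  then have "AE x in lebesgue. x \<in> U \<longrightarrow> h x = 0"
    by eventually_elim (use \<D>(4) in blast)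
  then show ?thesis using U_sets by (simp add: AE_restrict_space_iff)
qed

section \<open>Test functions and weak gradients\<close>

lemma test_function_smooth:
  assumes "\<psi> \<in> test_functions V"
  shows "\<psi> differentiable_on UNIV" "continuous_on UNIV \<psi>"
    and "e \<in> Basis \<Longrightarrow> continuous_on UNIV (partial_deriv e \<psi>)"
proof -
  have "C_k (Suc 0) \<psi>" using assms unfolding test_functions_def by blast
  then show "\<psi> differentiable_on UNIV" "e \<in> Basis \<Longrightarrow> continuous_on UNIV (partial_deriv e \<psi>)"
    by auto
  then show "continuous_on UNIV \<psi>" by (intro differentiable_imp_continuous_on)
qed

lemma partial_deriv_eq_0_outside_support:
  assumes "x \<notin> closure {x. \<psi> x \<noteq> 0}"
  shows "partial_deriv e \<psi> x = 0"
proof -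
  have "((\<lambda>_. 0) has_derivative (\<lambda>_. 0)) (at x)" by simp
  then have "(\<psi> has_derivative (\<lambda>_. 0)) (at x)"
  proof (rule has_derivative_transform_within_open)
    show "open (- closure {x. \<psi> x \<noteq> 0})" "x \<in> - closure {x. \<psi> x \<noteq> 0}" using assms by auto
    show "0 = \<psi> y" if "y \<in> - closure {x. \<psi> x \<noteq> 0}" for y
      using that closure_subset[of "{x. \<psi> x \<noteq> 0}"] by auto
  qed
  then show ?thesis
    unfolding partial_deriv_def by (metis frechet_derivative_at)
qed

lemma test_function_support:
  assumes "\<psi> \<in> test_functions V"
  obtains K where "compact K" "K \<subseteq> V"
    "\<And>x. x \<notin> K \<Longrightarrow> \<psi> x = 0" "\<And>x e. x \<notin> K \<Longrightarrow> partial_deriv e \<psi> x = 0"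
proof
  let ?K = "closure {x. \<psi> x \<noteq> 0}"
  show "compact ?K" "?K \<subseteq> V" using assms by (auto simp: test_functions_def)
  show "\<psi> x = 0" if "x \<notin> ?K" for x
    using that closure_subset[of "{x. \<psi> x \<noteq> 0}"] by auto
  show "partial_deriv e \<psi> x = 0" if "x \<notin> ?K" for x e
    using that by (rule partial_deriv_eq_0_outside_support)
qed

lemma test_function_zero_outside:
  assumes "\<psi> \<in> test_functions V" "x \<notin> V"
  shows "\<psi> x = 0" "partial_deriv e \<psi> x = 0"
  using test_function_support[OF assms(1)] assms(2) by (metis subsetD)+

definition grad :: "('a::euclidean_space \<Rightarrow> real) \<Rightarrow> 'a \<Rightarrow> 'a" where
  "grad \<psi> x = (\<Sum>e\<in>Basis. partial_deriv e \<psi> x *\<^sub>R e)"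

lemma grad_inner_Basis [simp]: "e \<in> Basis \<Longrightarrow> grad \<psi> x \<bullet> e = partial_deriv e \<psi> x"
  by (simp add: grad_def)

lemma grad_zero_outside: "\<psi> \<in> test_functions V \<Longrightarrow> x \<notin> V \<Longrightarrow> grad \<psi> x = 0"
  unfolding grad_def by (simp add: test_function_zero_outside(2))

lemma test_function_L2:
  fixes \<psi> :: "'a::euclidean_space \<Rightarrow> real"
  assumes "\<psi> \<in> test_functions V" "U \<in> sets lebesgue"
  shows "\<psi> \<in> L2 U" "e \<in> Basis \<Longrightarrow> partial_deriv e \<psi> \<in> L2 U" "grad \<psi> \<in> L2 U"
proof -
  obtain K where K: "compact K"
    "\<And>x. x \<notin> K \<Longrightarrow> \<psi> x = 0" "\<And>x e. x \<notin> K \<Longrightarrow> partial_deriv e \<psi> x = 0"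
    using test_function_support[OF assms(1)] by metis
  show "\<psi> \<in> L2 U"
    using assms(2) K(1) test_function_smooth(2)[OF assms(1)] K(2)
    by (rule L2_continuous_compact_support)
  show "partial_deriv e \<psi> \<in> L2 U" if "e \<in> Basis"
    using assms(2) K(1) test_function_smooth(3)[OF assms(1) that] K(3)
    by (rule L2_continuous_compact_support)
  have "continuous_on UNIV (\<lambda>x. \<Sum>e\<in>Basis. partial_deriv e \<psi> x *\<^sub>R e)"
    using test_function_smooth(3)[OF assms(1)] by (intro continuous_intros)
  then have "continuous_on UNIV (grad \<psi>)"
    by (simp add: grad_def[abs_def])
  moreover have "grad \<psi> x = 0" if "x \<notin> K" for x
    using that by (simp add: grad_def K(3))
  ultimately show "grad \<psi> \<in> L2 U"
    using assms(2) K(1) by (intro L2_continuous_compact_support)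
qed

lemma integral_by_parts_test_functions:
  fixes \<psi> \<eta> :: "'a::euclidean_space \<Rightarrow> real"
  assumes \<psi>: "\<psi> \<in> test_functions V" and \<eta>: "\<eta> \<in> test_functions W" and e: "e \<in> Basis"
  shows "(LINT x|lebesgue. \<psi> x * partial_deriv e \<eta> x + partial_deriv e \<psi> x * \<eta> x) = 0"
proof -
  let ?h = "\<lambda>x. \<psi> x * \<eta> x"
  have deriv: "(?h has_derivative (\<lambda>d. \<psi> x * frechet_derivative \<eta> (at x) d
      + frechet_derivative \<psi> (at x) d * \<eta> x)) (at x)" for x
    using test_function_smooth(1)[OF \<psi>] test_function_smooth(1)[OF \<eta>]
    by (intro has_derivative_mult)
       (auto simp: differentiable_on_def simp flip: frechet_derivative_works)
  have pd: "partial_deriv e ?h = (\<lambda>x. \<psi> x * partial_deriv e \<eta> x + partial_deriv e \<psi> x * \<eta> x)"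
    unfolding partial_deriv_def using frechet_derivative_at[OF deriv, symmetric] by (simp add: fun_eq_iff)
  have cont: "continuous_on UNIV (partial_deriv e ?h)"
    unfolding pd using test_function_smooth[OF \<psi>] test_function_smooth[OF \<eta>] e
    by (intro continuous_intros) auto
  obtain K where K: "compact K"
    "\<And>x. x \<notin> K \<Longrightarrow> \<psi> x = 0" "\<And>x e. x \<notin> K \<Longrightarrow> partial_deriv e \<psi> x = 0"
    using test_function_support[OF \<psi>] by metis
  have "?h differentiable_on UNIV"
    using deriv by (auto simp: differentiable_on_def differentiable_def)
  then have "(LINT x|lborel. partial_deriv e ?h x) = 0"
    using cont K(1) by (rule integral_partial_deriv_eq_0) (simp_all add: pd K)
  moreover have "(LINT x|lebesgue. partial_deriv e ?h x) = (LINT x|lborel. partial_deriv e ?h x)"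
    using borel_measurable_continuous_onI[OF cont] by (intro integral_completion) simp
  ultimately show ?thesis by (simp add: pd)
qed

text \<open>Here \<open>\<psi>\<close> is paired only with functions supported in \<open>U\<close>, so it may itself come from a larger
set. This serves both to place test functions of \<open>U\<close> in the Sobolev space and to integrate by parts on \<open>U\<close>
against a test function of a larger set.\<close>
lemma test_function_has_weak_grad:
  fixes U :: "'a::euclidean_space set"
  assumes U: "open U" and \<psi>: "\<psi> \<in> test_functions V"
  shows "has_weak_grad U \<psi> (grad \<psi>)"
  unfolding has_weak_grad_def
proof (intro ballI)
  fix \<eta> :: "'a \<Rightarrow> real" and e :: 'a
  assume \<eta>: "\<eta> \<in> test_functions U" and e: "e \<in> Basis"
  have U_sets: "U \<in> sets lebesgue" using U by auto
  have int: "integrable (lebesgue_on U) (\<lambda>x. \<psi> x * partial_deriv e \<eta> x)"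
       "integrable (lebesgue_on U) (\<lambda>x. partial_deriv e \<psi> x * \<eta> x)"
    using L2_integrable_inner[OF test_function_L2(1)[OF \<psi> U_sets] test_function_L2(2)[OF \<eta> U_sets e]]
      L2_integrable_inner[OF test_function_L2(2)[OF \<psi> U_sets e] test_function_L2(1)[OF \<eta> U_sets]]
    by simp_all
  have "(LINT x|lebesgue_on U. \<psi> x * partial_deriv e \<eta> x + partial_deriv e \<psi> x * \<eta> x)
      = (LINT x|lebesgue. \<psi> x * partial_deriv e \<eta> x + partial_deriv e \<psi> x * \<eta> x)"
    using integral_lebesgue_on_vanishing_off[OF U_sets, of UNIV
        "\<lambda>x. \<psi> x * partial_deriv e \<eta> x + partial_deriv e \<psi> x * \<eta> x"]
    by (simp add: lebesgue_on_UNIV_eq test_function_zero_outside[OF \<eta>])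
  also have "\<dots> = 0" by (rule integral_by_parts_test_functions[OF \<psi> \<eta> e])
  finally show "(LINT x|lebesgue_on U. \<psi> x * partial_deriv e \<eta> x)
      = - (LINT x|lebesgue_on U. (grad \<psi> x \<bullet> e) * \<eta> x)"
    using int e by simp
qed


lemma L2_scaleR_right:
  "f \<in> L2 U \<Longrightarrow> (\<lambda>x. f x *\<^sub>R c) \<in> L2 U"
  by (auto simp: L2_def power_mult_distrib)

lemma integrable_L2_test_function:
  fixes U :: "'a::euclidean_space set"
  assumes U: "U \<in> sets lebesgue" and \<psi>: "\<psi> \<in> test_functions V" and e: "e \<in> Basis"
  shows "u \<in> L2 U \<Longrightarrow> integrable (lebesgue_on U) (\<lambda>x. u x * partial_deriv e \<psi> x)"
    and "g \<in> L2 U \<Longrightarrow> integrable (lebesgue_on U) (\<lambda>x. (g x \<bullet> e) * \<psi> x)"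
  using L2_integrable_inner[OF _ test_function_L2(2)[OF \<psi> U e], of u]
    L2_integrable_inner[OF _ L2_scaleR_right[OF test_function_L2(1)[OF \<psi> U]], of g e]
  by (simp_all add: mult.commute)

lemma has_weak_grad_diff:
  fixes U :: "'a::euclidean_space set"
  assumes U: "U \<in> sets lebesgue" and L2: "u1 \<in> L2 U" "u2 \<in> L2 U" "g1 \<in> L2 U" "g2 \<in> L2 U"
    and "has_weak_grad U u1 g1" "has_weak_grad U u2 g2"
  shows "has_weak_grad U (\<lambda>x. u1 x - u2 x) (\<lambda>x. g1 x - g2 x)"
  unfolding has_weak_grad_def
proof (intro ballI)
  fix \<eta> :: "'a \<Rightarrow> real" and e :: 'a
  assume \<eta>: "\<eta> \<in> test_functions U" and e: "e \<in> Basis"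
  show "(LINT x|lebesgue_on U. (u1 x - u2 x) * partial_deriv e \<eta> x)
      = - (LINT x|lebesgue_on U. ((g1 x - g2 x) \<bullet> e) * \<eta> x)"
    using assms(6,7) \<eta> e
    by (simp add: has_weak_grad_def left_diff_distrib inner_diff_left
        integrable_L2_test_function[OF U \<eta> e] L2)
qed

text \<open>Uniqueness is what gives \<^const>\<open>weak_grad\<close>, an arbitrary choice of representative, any computable
value. It is stated with two functions so that it also covers equality almost everywhere.\<close>
lemma has_weak_grad_unique:
  fixes U :: "'a::euclidean_space set"
  assumes U: "open U" and "g1 \<in> L2 U" "g2 \<in> L2 U"
    and "has_weak_grad U u1 g1" "has_weak_grad U u2 g2"
    and eq: "AE x in lebesgue_on U. u1 x = u2 x"
    and u: "u1 \<in> L2 U" "u2 \<in> L2 U"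
  shows "AE x in lebesgue_on U. g1 x = g2 x"
proof -
  have U_sets: "U \<in> sets lebesgue" using U by auto
  have g: "(\<lambda>x. g1 x - g2 x) \<in> L2 U" using assms by (intro L2_diff)
  have weak: "has_weak_grad U (\<lambda>x. u1 x - u2 x) (\<lambda>x. g1 x - g2 x)"
    using assms U_sets by (intro has_weak_grad_diff)
  have "AE x in lebesgue_on U. (g1 x - g2 x) \<bullet> e = 0" if e: "e \<in> Basis" for e
  proof (rule AE_eq_0_if_orthogonal_test_functions[OF U])
    have "integrable (lebesgue_on U) (\<lambda>x. ((g1 x - g2 x) \<bullet> e)\<^sup>2)"
    proof (rule Bochner_Integration.integrable_bound)
      show "integrable (lebesgue_on U) (\<lambda>x. (norm (g1 x - g2 x))\<^sup>2)"
        using g by (rule L2_integrable_norm_sq)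
      show "(\<lambda>x. ((g1 x - g2 x) \<bullet> e)\<^sup>2) \<in> borel_measurable (lebesgue_on U)"
        using L2_measurable[OF g] by (intro borel_measurable_power borel_measurable_inner) auto
      show "AE x in lebesgue_on U. norm (((g1 x - g2 x) \<bullet> e)\<^sup>2) \<le> norm ((norm (g1 x - g2 x))\<^sup>2)"
        using e by (intro AE_I2) (simp add: abs_le_square_iff[symmetric] Basis_le_norm)
    qed
    then show "(\<lambda>x. (g1 x - g2 x) \<bullet> e) \<in> L2 U"
      using L2_measurable[OF g] by (simp add: L2_def borel_measurable_inner)
    fix \<psi> assume \<psi>: "\<psi> \<in> test_functions U"
    have "(LINT x|lebesgue_on U. ((g1 x - g2 x) \<bullet> e) * \<psi> x)
        = - (LINT x|lebesgue_on U. (u1 x - u2 x) * partial_deriv e \<psi> x)"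
      using weak \<psi> e by (simp add: has_weak_grad_def)
    also have "(LINT x|lebesgue_on U. (u1 x - u2 x) * partial_deriv e \<psi> x) = 0"
      using eq by (intro integral_eq_zero_AE) (auto elim!: eventually_mono)
    finally show "(LINT x|lebesgue_on U. ((g1 x - g2 x) \<bullet> e) * \<psi> x) = 0" by simp
  qed
  then have "AE x in lebesgue_on U. \<forall>e\<in>Basis. (g1 x - g2 x) \<bullet> e = 0"
    by (simp add: AE_ball_countable countable_finite)
  then show ?thesis
    by eventually_elim (simp add: inner_diff_left euclidean_eq_iff[of "g1 _"])
qed

lemma H1_weak_grad:
  assumes "u \<in> H1 U"
  shows "u \<in> L2 U" "weak_grad U u \<in> L2 U" "has_weak_grad U u (weak_grad U u)"
proof -
  have "\<exists>g. g \<in> L2 U \<and> has_weak_grad U u g" using assms by (auto simp: H1_def)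
  then have "weak_grad U u \<in> L2 U \<and> has_weak_grad U u (weak_grad U u)"
    unfolding weak_grad_def by (rule someI_ex)
  then show "weak_grad U u \<in> L2 U" "has_weak_grad U u (weak_grad U u)" by auto
  show "u \<in> L2 U" using assms by (simp add: H1_def)
qed

text \<open>This is how weak gradients are computed: any square integrable candidate that satisfies the
integration by parts formula agrees with the chosen representative.\<close>
lemma weak_grad_AE_eq:
  fixes U :: "'a::euclidean_space set"
  assumes "open U" "u \<in> L2 U" "g \<in> L2 U" "has_weak_grad U u g"
  shows "AE x in lebesgue_on U. weak_grad U u x = g x"
    and "L2_norm U (weak_grad U u) = L2_norm U g"
    and "u \<in> H1 U"
proof -
  show u: "u \<in> H1 U" using assms by (auto simp: H1_def)
  show *: "AE x in lebesgue_on U. weak_grad U u x = g x"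
    by (rule has_weak_grad_unique[OF assms(1) H1_weak_grad(2)[OF u] assms(3) H1_weak_grad(3)[OF u]
          assms(4) _ assms(2,2)]) simp
  show "L2_norm U (weak_grad U u) = L2_norm U g"
    using H1_weak_grad(2)[OF u] assms(3) * by (rule L2_norm_cong_AE)
qed

section \<open>Extension by zero\<close>

text \<open>Together with the next lemma this describes \<^const>\<open>H10\<close> by separate convergence of functions and of
gradients, with the classical gradients of the test functions in place of chosen representatives.\<close>
lemma H10_approximable:
  fixes U :: "'a::euclidean_space set"
  assumes U: "open U" and v: "v \<in> H10 U"
  obtains \<psi> where "\<And>k::nat. \<psi> k \<in> test_functions U"
    "(\<lambda>k. L2_norm U (\<lambda>x. \<psi> k x - v x)) \<longlonglongrightarrow> 0"
    "(\<lambda>k. L2_norm U (\<lambda>x. grad (\<psi> k) x - weak_grad U v x)) \<longlonglongrightarrow> 0"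
proof -
  have U_sets: "U \<in> sets lebesgue" using U by auto
  have vH1: "v \<in> H1 U" using v by (simp add: H10_def)
  obtain \<psi> where \<psi>: "\<And>k::nat. \<psi> k \<in> test_functions U"
    and lim: "(\<lambda>k. H1_norm U (\<lambda>x. \<psi> k x - v x)) \<longlonglongrightarrow> 0"
    using v by (auto simp: H10_def)
  have eq: "L2_norm U (weak_grad U (\<lambda>x. \<psi> k x - v x))
      = L2_norm U (\<lambda>x. grad (\<psi> k) x - weak_grad U v x)" for k
    using test_function_L2[OF \<psi> U_sets] H1_weak_grad[OF vH1] test_function_has_weak_grad[OF U \<psi>] U_sets
    by (intro weak_grad_AE_eq(2)[OF U] L2_diff has_weak_grad_diff)
  show ?thesis
  proof (rule that[OF \<psi>])
    show "(\<lambda>k. L2_norm U (\<lambda>x. \<psi> k x - v x)) \<longlonglongrightarrow> 0"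
      by (rule tendsto_sandwich[OF _ _ tendsto_const lim])
         (simp_all add: H1_norm_def real_le_rsqrt)
    show "(\<lambda>k. L2_norm U (\<lambda>x. grad (\<psi> k) x - weak_grad U v x)) \<longlonglongrightarrow> 0"
      by (rule tendsto_sandwich[OF _ _ tendsto_const lim])
         (simp_all add: H1_norm_def real_le_rsqrt eq)
  qed
qed

lemma H10_I:
  fixes U :: "'a::euclidean_space set"
  assumes U: "open U" and v: "v \<in> L2 U" "g \<in> L2 U" "has_weak_grad U v g"
    and \<psi>: "\<And>k::nat. \<psi> k \<in> test_functions U"
    and lim: "(\<lambda>k. L2_norm U (\<lambda>x. \<psi> k x - v x)) \<longlonglongrightarrow> 0"
      "(\<lambda>k. L2_norm U (\<lambda>x. grad (\<psi> k) x - g x)) \<longlonglongrightarrow> 0"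
  shows "v \<in> H10 U"
proof -
  have U_sets: "U \<in> sets lebesgue" using U by auto
  have eq: "L2_norm U (weak_grad U (\<lambda>x. \<psi> k x - v x)) = L2_norm U (\<lambda>x. grad (\<psi> k) x - g x)" for k
    using test_function_L2[OF \<psi> U_sets] v test_function_has_weak_grad[OF U \<psi>] U_sets
    by (intro weak_grad_AE_eq(2)[OF U] L2_diff has_weak_grad_diff)
  have "(\<lambda>k. H1_norm U (\<lambda>x. \<psi> k x - v x)) \<longlonglongrightarrow> sqrt (0\<^sup>2 + 0\<^sup>2)"
    unfolding H1_norm_def eq by (intro tendsto_intros lim)
  then show ?thesis
    using \<psi> weak_grad_AE_eq(3)[OF U v] by (auto simp: H10_def)
qed

text \<open>No jump across the boundary of \<open>U\<close> contributes to the gradient, because \<open>v\<close> is a limit of functions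
\<open>\<psi> k\<close> with compact support in \<open>U\<close>. The defect of the integration by parts formula on \<open>U\<close> is zero for
each \<open>\<psi> k\<close> and continuous in the norm of \<open>H\<^sup>1\<close>, so it is zero for \<open>v\<close>.\<close>
lemma zero_ext_has_weak_grad:
  fixes U D :: "'a::euclidean_space set"
  assumes U: "open U" and D: "open D" and "U \<subseteq> D" and v: "v \<in> H10 U"
  shows "has_weak_grad D (zero_ext U v) (\<lambda>x. if x \<in> U then weak_grad U v x else 0)"
  unfolding has_weak_grad_def
proof (intro ballI)
  fix \<eta> :: "'a \<Rightarrow> real" and e :: 'a
  assume \<eta>: "\<eta> \<in> test_functions D" and e: "e \<in> Basis"
  have U_sets: "U \<in> sets lebesgue" and D_sets: "D \<in> sets lebesgue" using U D by auto
  let ?g = "weak_grad U v"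
  have vg: "v \<in> L2 U" "?g \<in> L2 U" using v H1_weak_grad[of v U] by (auto simp: H10_def)
  obtain \<psi> where \<psi>: "\<And>k::nat. \<psi> k \<in> test_functions U"
    and lim: "(\<lambda>k. L2_norm U (\<lambda>x. \<psi> k x - v x)) \<longlonglongrightarrow> 0"
      "(\<lambda>k. L2_norm U (\<lambda>x. grad (\<psi> k) x - ?g x)) \<longlonglongrightarrow> 0"
    using H10_approximable[OF U v] by blast
  note \<psi>_L2 = test_function_L2[OF \<psi> U_sets]
  define E where "E = (LINT x|lebesgue_on U. v x * partial_deriv e \<eta> x)
      + (LINT x|lebesgue_on U. (?g x \<bullet> e) * \<eta> x)"
  have bound: "\<bar>E\<bar> \<le> L2_norm U (\<lambda>x. \<psi> k x - v x) * L2_norm U (partial_deriv e \<eta>)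
      + L2_norm U (\<lambda>x. grad (\<psi> k) x - ?g x) * L2_norm U (\<lambda>x. \<eta> x *\<^sub>R e)" for k
  proof -
    \<comment> \<open>The roles are exchanged: \<open>\<psi> k\<close> is a legitimate test function on \<open>U\<close>, unlike \<open>\<eta>\<close>.\<close>
    have "(LINT x|lebesgue_on U. \<eta> x * partial_deriv e (\<psi> k) x)
        = - (LINT x|lebesgue_on U. partial_deriv e \<eta> x * \<psi> k x)"
      using test_function_has_weak_grad[OF U \<eta>] \<psi> e by (simp add: has_weak_grad_def)
    then have parts: "(LINT x|lebesgue_on U. \<psi> k x * partial_deriv e \<eta> x)
        = - (LINT x|lebesgue_on U. (grad (\<psi> k) x \<bullet> e) * \<eta> x)"
      using e by (simp add: mult.commute)
    have 1: "(LINT x|lebesgue_on U. (\<psi> k x - v x) * partial_deriv e \<eta> x)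
        = (LINT x|lebesgue_on U. \<psi> k x * partial_deriv e \<eta> x)
          - (LINT x|lebesgue_on U. v x * partial_deriv e \<eta> x)"
      by (simp add: left_diff_distrib integrable_L2_test_function[OF U_sets \<eta> e] \<psi>_L2 vg)
    have 2: "(LINT x|lebesgue_on U. ((grad (\<psi> k) x - ?g x) \<bullet> e) * \<eta> x)
        = (LINT x|lebesgue_on U. (grad (\<psi> k) x \<bullet> e) * \<eta> x)
          - (LINT x|lebesgue_on U. (?g x \<bullet> e) * \<eta> x)"
      unfolding inner_diff_left left_diff_distrib
      by (intro Bochner_Integration.integral_diff integrable_L2_test_function[OF U_sets \<eta> e] \<psi>_L2 vg)
    define X where "X = (LINT x|lebesgue_on U. (\<psi> k x - v x) \<bullet> partial_deriv e \<eta> x)"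
    define Y where "Y = (LINT x|lebesgue_on U. (grad (\<psi> k) x - ?g x) \<bullet> (\<eta> x *\<^sub>R e))"
    have "X = (LINT x|lebesgue_on U. (\<psi> k x - v x) * partial_deriv e \<eta> x)"
      by (simp add: X_def)
    moreover have "Y = (LINT x|lebesgue_on U. ((grad (\<psi> k) x - ?g x) \<bullet> e) * \<eta> x)"
      unfolding Y_def inner_scaleR_right by (simp only: mult.commute)
    ultimately have "E = - (X + Y)"
      using parts 1 2 unfolding E_def by linarith
    then have "\<bar>E\<bar> \<le> \<bar>X\<bar> + \<bar>Y\<bar>" by linarith
    also have "\<bar>X\<bar> \<le> L2_norm U (\<lambda>x. \<psi> k x - v x) * L2_norm U (partial_deriv e \<eta>)"
      unfolding X_def
      by (rule L2_Cauchy_Schwarz[OF L2_diff[OF \<psi>_L2(1) vg(1)] test_function_L2(2)[OF \<eta> U_sets e]])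
    also have "\<bar>Y\<bar> \<le> L2_norm U (\<lambda>x. grad (\<psi> k) x - ?g x) * L2_norm U (\<lambda>x. \<eta> x *\<^sub>R e)"
      unfolding Y_def
      by (rule L2_Cauchy_Schwarz[OF L2_diff[OF \<psi>_L2(3) vg(2)]
            L2_scaleR_right[OF test_function_L2(1)[OF \<eta> U_sets]]])
    finally show ?thesis by simp
  qed
  have "(\<lambda>k. L2_norm U (\<lambda>x. \<psi> k x - v x) * L2_norm U (partial_deriv e \<eta>)
      + L2_norm U (\<lambda>x. grad (\<psi> k) x - ?g x) * L2_norm U (\<lambda>x. \<eta> x *\<^sub>R e)) \<longlonglongrightarrow>
      0 * L2_norm U (partial_deriv e \<eta>) + 0 * L2_norm U (\<lambda>x. \<eta> x *\<^sub>R e)"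
    by (intro tendsto_intros lim)
  then have "\<bar>E\<bar> \<le> 0 * L2_norm U (partial_deriv e \<eta>) + 0 * L2_norm U (\<lambda>x. \<eta> x *\<^sub>R e)"
    by (rule LIMSEQ_le_const) (use bound in auto)
  then have "E = 0" by simp
  have "(LINT x|lebesgue_on D. zero_ext U v x * partial_deriv e \<eta> x)
      = (LINT x|lebesgue_on U. zero_ext U v x * partial_deriv e \<eta> x)"
    by (rule integral_lebesgue_on_vanishing_off[OF U_sets D_sets \<open>U \<subseteq> D\<close>]) (simp add: zero_ext_def)
  also have "\<dots> = (LINT x|lebesgue_on U. v x * partial_deriv e \<eta> x)"
    by (rule Bochner_Integration.integral_cong) (simp_all add: zero_ext_def)
  finally have 1: "(LINT x|lebesgue_on D. zero_ext U v x * partial_deriv e \<eta> x)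
      = (LINT x|lebesgue_on U. v x * partial_deriv e \<eta> x)" .
  have "(LINT x|lebesgue_on D. ((if x \<in> U then ?g x else 0) \<bullet> e) * \<eta> x)
      = (LINT x|lebesgue_on U. ((if x \<in> U then ?g x else 0) \<bullet> e) * \<eta> x)"
    by (rule integral_lebesgue_on_vanishing_off[OF U_sets D_sets \<open>U \<subseteq> D\<close>]) simp
  also have "\<dots> = (LINT x|lebesgue_on U. (?g x \<bullet> e) * \<eta> x)"
    by (rule Bochner_Integration.integral_cong) simp_all
  finally have 2: "(LINT x|lebesgue_on D. ((if x \<in> U then ?g x else 0) \<bullet> e) * \<eta> x)
      = (LINT x|lebesgue_on U. (?g x \<bullet> e) * \<eta> x)" .
  show "(LINT x|lebesgue_on D. zero_ext U v x * partial_deriv e \<eta> x)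
      = - (LINT x|lebesgue_on D. ((if x \<in> U then ?g x else 0) \<bullet> e) * \<eta> x)"
    using \<open>E = 0\<close> unfolding 1 2 E_def by simp
qed

lemma test_functions_mono: "U \<subseteq> D \<Longrightarrow> test_functions U \<subseteq> test_functions D"
  by (auto simp: test_functions_def)

text \<open>The functions that approximate \<open>v\<close> on \<open>U\<close> also approximate its extension on \<open>D\<close>, since everything
vanishes on the difference of the two sets.\<close>
lemma zero_ext_H10:
  fixes U D :: "'a::euclidean_space set"
  assumes U: "open U" and D: "open D" and "U \<subseteq> D" and v: "v \<in> H10 U"
  shows "zero_ext U v \<in> H10 D"
    and "AE x in lebesgue_on D. weak_grad D (zero_ext U v) x = (if x \<in> U then weak_grad U v x else 0)"
proof -
  have U_sets: "U \<in> sets lebesgue" and D_sets: "D \<in> sets lebesgue" using U D by auto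
  note ext = L2_extend_by_0[OF U_sets D_sets \<open>U \<subseteq> D\<close>]
  let ?g = "weak_grad U v" and ?G = "\<lambda>x. if x \<in> U then weak_grad U v x else 0"
  have vg: "v \<in> L2 U" "?g \<in> L2 U" using v H1_weak_grad[of v U] by (auto simp: H10_def)
  have L2: "zero_ext U v \<in> L2 D" "?G \<in> L2 D"
    unfolding zero_ext_def using vg by (auto intro: ext(1))
  have weak: "has_weak_grad D (zero_ext U v) ?G" using assms by (rule zero_ext_has_weak_grad)
  show "AE x in lebesgue_on D. weak_grad D (zero_ext U v) x = ?G x"
    using D L2 weak by (rule weak_grad_AE_eq(1))
  obtain \<psi> where \<psi>: "\<And>k::nat. \<psi> k \<in> test_functions U"
    and lim: "(\<lambda>k. L2_norm U (\<lambda>x. \<psi> k x - v x)) \<longlonglongrightarrow> 0"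
      "(\<lambda>k. L2_norm U (\<lambda>x. grad (\<psi> k) x - ?g x)) \<longlonglongrightarrow> 0"
    using H10_approximable[OF U v] by blast
  note \<psi>_L2 = test_function_L2[OF \<psi> U_sets]
  show "zero_ext U v \<in> H10 D"
  proof (rule H10_I[OF D L2 weak])
    show "\<psi> k \<in> test_functions D" for k
      using \<psi> test_functions_mono[OF \<open>U \<subseteq> D\<close>] by blast
    have "(\<lambda>x. \<psi> k x - zero_ext U v x) = (\<lambda>x. if x \<in> U then \<psi> k x - v x else 0)" for k
      using test_function_zero_outside(1)[OF \<psi>] by (auto simp: zero_ext_def fun_eq_iff)
    then show "(\<lambda>k. L2_norm D (\<lambda>x. \<psi> k x - zero_ext U v x)) \<longlonglongrightarrow> 0"
      using lim(1) by (simp add: ext(2) L2_diff \<psi>_L2 vg)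
    have "(\<lambda>x. grad (\<psi> k) x - ?G x) = (\<lambda>x. if x \<in> U then grad (\<psi> k) x - ?g x else 0)" for k
      using grad_zero_outside[OF \<psi>] by (auto simp: fun_eq_iff)
    then show "(\<lambda>k. L2_norm D (\<lambda>x. grad (\<psi> k) x - ?G x)) \<longlonglongrightarrow> 0"
      using lim(2) by (simp add: ext(2) L2_diff \<psi>_L2 vg)
  qed
qed

text \<open>This makes the supremum that defines the dual norm one over a nonempty set.\<close>
lemma zero_function_in_H10:
  fixes U :: "'a::euclidean_space set"
  assumes U: "open U"
  shows "(\<lambda>x. 0) \<in> H10 U" "L2_norm U (weak_grad U (\<lambda>x. 0)) = 0"
proof -
  have grad0: "grad (\<lambda>x::'a. 0) = (\<lambda>x. 0)"
    using grad_zero_outside[OF zero_in_test_functions[of "{} :: 'a set"]] by (simp add: fun_eq_iff)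
  have L2: "(\<lambda>x. 0 :: real) \<in> L2 U" "(\<lambda>x. 0 :: 'a) \<in> L2 U" by (auto simp: L2_def)
  have weak: "has_weak_grad U (\<lambda>x. 0) (\<lambda>x. 0)" by (simp add: has_weak_grad_def)
  show "L2_norm U (weak_grad U (\<lambda>x. 0)) = 0"
    using weak_grad_AE_eq(2)[OF U L2 weak] by (simp add: L2_norm_def)
  show "(\<lambda>x. 0) \<in> H10 U"
    by (rule H10_I[OF U L2 weak, of "\<lambda>_ _. 0"])
       (simp_all add: zero_in_test_functions grad0 L2_norm_def)
qed

section \<open>Stability of the coefficients\<close>

lemma AE_lebesgue_on_subset:
  assumes "U \<in> sets lebesgue" "D \<in> sets lebesgue" "U \<subseteq> D" "AE x in lebesgue_on D. P x"
  shows "AE x in lebesgue_on U. P x"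
proof -
  have "AE x in lebesgue. x \<in> D \<longrightarrow> P x" using assms(2,4) by (simp add: AE_restrict_space_iff)
  then have "AE x in lebesgue. x \<in> U \<longrightarrow> P x" by eventually_elim (use assms(3) in blast)
  then show ?thesis using assms(1) by (simp add: AE_restrict_space_iff)
qed

text \<open>A test function supported in a set on which the coefficient is constant sees only that constant,
which therefore factors out of the weak form.\<close>
lemma weak_solution_tested_locally:
  fixes U D :: "'a::euclidean_space set"
  assumes U: "open U" and D: "open D" and "U \<subseteq> D"
    and sol: "weak_solution D a f \<phi> u"
    and a: "a \<in> borel_measurable (lebesgue_on D)" "\<And>x. x \<in> U \<Longrightarrow> a x = c"
    and v: "v \<in> H10 U"
  shows "restrict_dual U f v = c * (LINT x|lebesgue_on U. weak_grad D u x \<bullet> weak_grad U v x)"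
proof -
  have U_sets: "U \<in> sets lebesgue" and D_sets: "D \<in> sets lebesgue" using U D by auto
  let ?w = "zero_ext U v" and ?G = "\<lambda>x. if x \<in> U then weak_grad U v x else 0"
  note w = zero_ext_H10[OF U D \<open>U \<subseteq> D\<close> v]
  have v_H1: "v \<in> H1 U" and w_H1: "?w \<in> H1 D" and u_H1: "u \<in> H1 D"
    using v w(1) sol by (auto simp: H10_def weak_solution_def)
  have meas: "weak_grad D u \<in> borel_measurable (lebesgue_on D)"
      "weak_grad D ?w \<in> borel_measurable (lebesgue_on D)" "?G \<in> borel_measurable (lebesgue_on D)"
    using H1_weak_grad(2)[OF u_H1] H1_weak_grad(2)[OF w_H1]
      L2_extend_by_0(1)[OF U_sets D_sets \<open>U \<subseteq> D\<close> H1_weak_grad(2)[OF v_H1]]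
    by (auto intro: L2_measurable)
  have "restrict_dual U f v = (LINT x|lebesgue_on D. a x * (weak_grad D u x \<bullet> weak_grad D ?w x))"
    using sol w(1) by (simp add: restrict_dual_def weak_solution_def)
  also have "\<dots> = (LINT x|lebesgue_on D. a x * (weak_grad D u x \<bullet> ?G x))"
  proof (rule integral_cong_AE)
    show "(\<lambda>x. a x * (weak_grad D u x \<bullet> weak_grad D ?w x)) \<in> borel_measurable (lebesgue_on D)"
      "(\<lambda>x. a x * (weak_grad D u x \<bullet> ?G x)) \<in> borel_measurable (lebesgue_on D)"
      by (intro borel_measurable_times[OF a(1)] borel_measurable_inner meas)+
    show "AE x in lebesgue_on D. a x * (weak_grad D u x \<bullet> weak_grad D ?w x) = a x * (weak_grad D u x \<bullet> ?G x)"
      using w(2) by eventually_elim simp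
  qed
  also have "\<dots> = (LINT x|lebesgue_on U. a x * (weak_grad D u x \<bullet> ?G x))"
    by (rule integral_lebesgue_on_vanishing_off[OF U_sets D_sets \<open>U \<subseteq> D\<close>]) simp
  also have "\<dots> = (LINT x|lebesgue_on U. c * (weak_grad D u x \<bullet> weak_grad U v x))"
    by (rule Bochner_Integration.integral_cong) (simp_all add: a(2))
  finally show ?thesis by simp
qed

lemma piecewise_const_eq:
  assumes "disjoint_family_on E {1..n}" "i \<in> {1..n}" "x \<in> E i"
  shows "piecewise_const n E c x = c i"
proof -
  have "c j * indicator (E j) x = (if j = i then c i else 0)" if "j \<in> {1..n}" for j
    using disjoint_family_onD[OF assms(1) that assms(2)] assms(3) by (auto simp: indicator_def)
  then have "piecewise_const n E c x = (\<Sum>j = 1..n. if j = i then c i else 0)"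
    unfolding piecewise_const_def by (intro sum.cong) auto
  then show ?thesis using assms(2) by simp
qed

lemma piecewise_const_measurable:
  fixes E :: "nat \<Rightarrow> 'a::euclidean_space set"
  assumes "\<And>j. j \<in> {1..n} \<Longrightarrow> open (E j)"
  shows "piecewise_const n E c \<in> borel_measurable (lebesgue_on D)"
proof -
  have "piecewise_const n E c \<in> borel_measurable lebesgue"
    unfolding piecewise_const_def using assms
    by (intro borel_measurable_sum borel_measurable_times borel_measurable_const borel_measurable_indicator) auto
  then show ?thesis by (rule measurable_restrict_space1)
qed

text \<open>Dividing the two local weak forms by their constants gives
\<open>\<integral> \<nabla>(ua - ub) \<bullet> \<nabla>v = (1 / \<alpha> - 1 / \<beta>) f(v)\<close> over \<open>U\<close>. Multiplied by \<open>\<alpha> \<beta> \<le> lmax\<^sup>2\<close> and estimated by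
Cauchy--Schwarz, this bounds \<open>f(v)\<close> for each admissible \<open>v\<close>, and then the supremum.\<close>
lemma coefficient_stability_on_piece:
  fixes U D :: "'a::euclidean_space set"
  assumes U: "open U" and D: "open D" and "U \<subseteq> D"
    and sol_a: "weak_solution D a f \<phi> ua" and sol_b: "weak_solution D b f \<phi> ub"
    and a: "a \<in> borel_measurable (lebesgue_on D)" "\<And>x. x \<in> U \<Longrightarrow> a x = \<alpha>"
    and b: "b \<in> borel_measurable (lebesgue_on D)" "\<And>x. x \<in> U \<Longrightarrow> b x = \<beta>"
    and \<alpha>: "0 < \<alpha>" "\<alpha> \<le> lmax" and \<beta>: "0 < \<beta>" "\<beta> \<le> lmax"
  shows "\<bar>\<alpha> - \<beta>\<bar> * Hm1_norm U (restrict_dual U f)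
    \<le> lmax\<^sup>2 * L2_norm U (weak_grad D (\<lambda>x. ua x - ub x))"
proof (cases "\<alpha> = \<beta>")
  case True
  then show ?thesis by simp
next
  case False
  have U_sets: "U \<in> sets lebesgue" and D_sets: "D \<in> sets lebesgue" using U D by auto
  let ?ga = "weak_grad D ua" and ?gb = "weak_grad D ub"
  let ?R = "lmax\<^sup>2 * L2_norm U (weak_grad D (\<lambda>x. ua x - ub x))"
  have H1: "ua \<in> H1 D" "ub \<in> H1 D" using sol_a sol_b by (auto simp: weak_solution_def)
  note Ha = H1_weak_grad[OF H1(1)] and Hb = H1_weak_grad[OF H1(2)]
  have diff: "(\<lambda>x. ua x - ub x) \<in> L2 D" "(\<lambda>x. ?ga x - ?gb x) \<in> L2 D"
    "has_weak_grad D (\<lambda>x. ua x - ub x) (\<lambda>x. ?ga x - ?gb x)"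
    using Ha Hb D_sets by (auto intro: L2_diff has_weak_grad_diff)
  note sub = L2_subset[OF U_sets D_sets \<open>U \<subseteq> D\<close>]
  note wg = weak_grad_AE_eq[OF D diff]
  have norm_eq: "L2_norm U (weak_grad D (\<lambda>x. ua x - ub x)) = L2_norm U (\<lambda>x. ?ga x - ?gb x)"
    using sub[OF H1_weak_grad(2)[OF wg(3)]] sub[OF diff(2)]
      AE_lebesgue_on_subset[OF U_sets D_sets \<open>U \<subseteq> D\<close> wg(1)]
    by (rule L2_norm_cong_AE)
  have bound: "\<bar>\<alpha> - \<beta>\<bar> * restrict_dual U f v \<le> ?R"
    if v: "v \<in> H10 U" "L2_norm U (weak_grad U v) \<le> 1" for v
  proof -
    let ?g = "weak_grad U v" and ?F = "restrict_dual U f v"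
    have g: "?g \<in> L2 U" using v(1) H1_weak_grad(2)[of v U] by (simp add: H10_def)
    define Ia where "Ia = (LINT x|lebesgue_on U. ?ga x \<bullet> ?g x)"
    define Ib where "Ib = (LINT x|lebesgue_on U. ?gb x \<bullet> ?g x)"
    have F: "?F = \<alpha> * Ia" "?F = \<beta> * Ib"
      unfolding Ia_def Ib_def
      using weak_solution_tested_locally[OF U D \<open>U \<subseteq> D\<close> sol_a a v(1)]
        weak_solution_tested_locally[OF U D \<open>U \<subseteq> D\<close> sol_b b v(1)] by blast+
    have "Ia - Ib = (LINT x|lebesgue_on U. (?ga x - ?gb x) \<bullet> ?g x)"
      unfolding Ia_def Ib_def inner_diff_left
      by (intro Bochner_Integration.integral_diff[symmetric] L2_integrable_inner sub Ha Hb g)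
    then have "\<bar>Ia - Ib\<bar> \<le> L2_norm U (\<lambda>x. ?ga x - ?gb x) * L2_norm U ?g"
      using L2_Cauchy_Schwarz[OF sub[OF diff(2)] g] by simp
    also have "\<dots> \<le> L2_norm U (\<lambda>x. ?ga x - ?gb x)"
      using v(2) mult_left_mono[of "L2_norm U ?g" 1 "L2_norm U (\<lambda>x. ?ga x - ?gb x)"] by simp
    finally have I: "\<bar>Ia - Ib\<bar> \<le> L2_norm U (\<lambda>x. ?ga x - ?gb x)" .
    have "(\<beta> - \<alpha>) * ?F = \<alpha> * \<beta> * (Ia - Ib)"
      using F by (simp add: algebra_simps)
    then have "\<bar>\<beta> - \<alpha>\<bar> * \<bar>?F\<bar> = \<alpha> * \<beta> * \<bar>Ia - Ib\<bar>"
      using \<alpha> \<beta> by (metis abs_mult abs_of_pos)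
    also have "\<dots> \<le> (lmax * lmax) * L2_norm U (\<lambda>x. ?ga x - ?gb x)"
      using \<alpha> \<beta> I by (intro mult_mono) auto
    finally have "\<bar>\<alpha> - \<beta>\<bar> * \<bar>?F\<bar> \<le> ?R"
      by (simp add: norm_eq power2_eq_square abs_minus_commute)
    moreover have "\<bar>\<alpha> - \<beta>\<bar> * ?F \<le> \<bar>\<alpha> - \<beta>\<bar> * \<bar>?F\<bar>" by (intro mult_left_mono) auto
    ultimately show ?thesis by linarith
  qed
  have pos: "\<bar>\<alpha> - \<beta>\<bar> > 0" using False by simp
  have "Hm1_norm U (restrict_dual U f) \<le> ?R / \<bar>\<alpha> - \<beta>\<bar>"
    unfolding Hm1_norm_def
  proof (rule cSUP_least)
    show "{v \<in> H10 U. L2_norm U (weak_grad U v) \<le> 1} \<noteq> {}"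
      using zero_function_in_H10[OF U] by (auto intro!: exI[of _ "\<lambda>_. 0"])
    show "restrict_dual U f v \<le> ?R / \<bar>\<alpha> - \<beta>\<bar>"
      if "v \<in> {v \<in> H10 U. L2_norm U (weak_grad U v) \<le> 1}" for v
      using bound[of v] that pos by (simp add: pos_le_divide_eq mult.commute)
  qed
  then show ?thesis using pos by (simp add: pos_le_divide_eq mult.commute)
qed

theorem theorem1:
  fixes D :: "'a::euclidean_space set" and Dp :: "nat \<Rightarrow> 'a set" and n :: nat
    and lmin lmax :: real and \<phi> :: "'a \<Rightarrow> real" and f :: "('a \<Rightarrow> real) \<Rightarrow> real"
    and av bv :: "nat \<Rightarrow> real" and a b ua ub :: "'a \<Rightarrow> real"
  assumes "domain D" and "bounded D"
    and "0 < lmin" and "lmin < lmax"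
    and "\<phi> \<in> H1 D" and "f \<in> Hm1 D"
    and "is_partition n Dp D"
    and "\<And>j. j \<in> {1..n} \<Longrightarrow> lipschitz_domain (Dp j)"
    and "\<And>j. j \<in> {1..n} \<Longrightarrow> av j \<in> {lmin..lmax}"
    and "\<And>j. j \<in> {1..n} \<Longrightarrow> bv j \<in> {lmin..lmax}"
    and "a = piecewise_const n Dp av" and "b = piecewise_const n Dp bv"
    and "weak_solution D a f \<phi> ua" and "weak_solution D b f \<phi> ub"
  shows "(\<forall>i \<in> {1..n}.
            \<bar>av i - bv i\<bar> * Hm1_norm (Dp i) (restrict_dual (Dp i) f)
              \<le> lmax\<^sup>2 * L2_norm (Dp i) (weak_grad D (\<lambda>x. ua x - ub x))) \<and>
         (Min ((\<lambda>i. Hm1_norm (Dp i) (restrict_dual (Dp i) f)) ` {1..n}) > 0 \<longrightarrow>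
            (AE x in lebesgue_on D. ua x = ub x) \<longrightarrow> a = b)"
proof (intro conjI ballI impI)
  have D: "open D" using assms(1) by (simp add: domain_def)
  have Dp: "open (Dp j)" "Dp j \<subseteq> D" if "j \<in> {1..n}" for j
    using assms(7) that by (auto simp: is_partition_def)
  have disj: "disjoint_family_on Dp {1..n}" using assms(7) by (simp add: is_partition_def)
  have estimate: "\<bar>av i - bv i\<bar> * Hm1_norm (Dp i) (restrict_dual (Dp i) f)
      \<le> lmax\<^sup>2 * L2_norm (Dp i) (weak_grad D (\<lambda>x. ua x - ub x))" if i: "i \<in> {1..n}" for i
  proof (rule coefficient_stability_on_piece[OF Dp(1)[OF i] D Dp(2)[OF i] assms(13,14)])
    show "a \<in> borel_measurable (lebesgue_on D)" "b \<in> borel_measurable (lebesgue_on D)"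
      using Dp(1) by (auto simp: assms(11,12) intro: piecewise_const_measurable)
    show "a x = av i" "b x = bv i" if "x \<in> Dp i" for x
      using piecewise_const_eq[OF disj i that] by (simp_all add: assms(11,12))
    show "0 < av i" "av i \<le> lmax" "0 < bv i" "bv i \<le> lmax"
      using assms(3) assms(9,10)[OF i] by auto
  qed
  then show "\<bar>av i - bv i\<bar> * Hm1_norm (Dp i) (restrict_dual (Dp i) f)
      \<le> lmax\<^sup>2 * L2_norm (Dp i) (weak_grad D (\<lambda>x. ua x - ub x))" if "i \<in> {1..n}" for i
    using that .
  assume pos: "Min ((\<lambda>i. Hm1_norm (Dp i) (restrict_dual (Dp i) f)) ` {1..n}) > 0"
    and eq: "AE x in lebesgue_on D. ua x = ub x"
  have H1: "ua \<in> H1 D" "ub \<in> H1 D" using assms(13,14) by (auto simp: weak_solution_def)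
  have diff: "(\<lambda>x. ua x - ub x) \<in> L2 D"
    using H1_weak_grad(1)[OF H1(1)] H1_weak_grad(1)[OF H1(2)] by (rule L2_diff)
  have "(\<lambda>x. ua x - ub x) \<in> H1 D"
    using H1_weak_grad[OF H1(1)] H1_weak_grad[OF H1(2)] D
    by (intro weak_grad_AE_eq(3)[OF D _ _ has_weak_grad_diff] L2_diff) auto
  note wg = H1_weak_grad[OF this]
  have L2_zero: "(\<lambda>x. 0 :: 'a) \<in> L2 U" "(\<lambda>x. 0 :: real) \<in> L2 U" for U :: "'a set"
    by (auto simp: L2_def)
  have grad_0: "AE x in lebesgue_on D. weak_grad D (\<lambda>x. ua x - ub x) x = 0"
    by (rule has_weak_grad_unique[OF D wg(2) L2_zero(1) wg(3) _ _ diff L2_zero(2)])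
       (use eq in \<open>auto simp: has_weak_grad_def elim!: eventually_mono\<close>)
  have "av i = bv i" if i: "i \<in> {1..n}" for i
  proof -
    have sets: "Dp i \<in> sets lebesgue" "D \<in> sets lebesgue" using Dp(1)[OF i] D by auto
    have "L2_norm (Dp i) (weak_grad D (\<lambda>x. ua x - ub x)) = L2_norm (Dp i) (\<lambda>x. 0 :: 'a)"
      using L2_subset[OF sets Dp(2)[OF i] wg(2)] L2_zero(1)
        AE_lebesgue_on_subset[OF sets Dp(2)[OF i] grad_0]
      by (rule L2_norm_cong_AE)
    then have "\<bar>av i - bv i\<bar> * Hm1_norm (Dp i) (restrict_dual (Dp i) f) \<le> 0"
      using estimate[OF i] by (simp add: L2_norm_def)
    moreover have "Hm1_norm (Dp i) (restrict_dual (Dp i) f) > 0"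
      using pos i by (subst (asm) Min_gr_iff) auto
    ultimately show ?thesis by (simp add: mult_le_0_iff)
  qed
  then show "a = b"
    unfolding assms(11,12) piecewise_const_def by (intro ext sum.cong) auto
qed

end
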